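(* Let $p\geq q\geq 1$ and $n$ be integers with $p+q\leq n-1$ and $n\not\equiv p+q \pmod 2$, and let $G\in\mathcal{G}_{n,p,q}$ be a bipartite digraph. Then $q(G)\geq q(B^1_{n,p,q})$, and equality holds if and only if $G\cong B^1_{n,p,q}$.
   Context: All digraphs are finite and simple (no loops, no multiple arcs). A digraph is strongly connected if for every pair of vertices $u,v$ there is a directed path from $u$ to $v$. A digraph is bipartite if its vertex set is a disjoint union $U\cup W$ such that every arc goes from $U$ to $W$ or from $W$ to $U$. For a digraph $G$ with vertices $v_1,\dots,v_n$, let $A(G)=(a_{ij})$ be the adjacency matrix ($a_{ij}=1$ if $(v_i,v_j)$ is an arc, i.e. an arc from $v_i$ to $v_j$, and $a_{ij}=0$ otherwise), $D(G)=\mathrm{diag}(d_1^+,\dots,d_n^+)$ the diagonal matrix of outdegrees, and $Q(G)=D(G)+A(G)$ the signless Laplacian matrix. The Q-index $q(G)$ is the spectral radius of $Q(G)$, i.e. the largest modulus of its eigenvalues. $\overleftrightarrow{K_{p,q}}$ is the complete bipartite digraph with parts $V_p=\{v_1,\dots,v_p\}$ and $V_q=\{v_{p+1},\dots,v_{p+q}\}$ and with both arcs $(u,v)$ and $(v,u)$ for all $u\in V_p$, $v\in V_q$. $\mathcal{G}_{n,p,q}$ is the set of strongly connected bipartite digraphs on $n$ vertices which contain $\overleftrightarrow{K_{p,q}}$ as a subdigraph (up to isomorphism). $B^1_{n,p,q}$ is the digraph on $\{v_1,\dots,v_n\}$ obtained from $\overleftrightarrow{K_{p,q}}$ by adding the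 directed path $v_1v_{p+q+1}v_{p+q+2}\cdots v_nv_p$, i.e. adding new vertices $v_{p+q+1},\dots,v_n$ and the arcs $(v_1,v_{p+q+1})$, $(v_i,v_{i+1})$ for $p+q+1\le i\le n-1$, and $(v_n,v_p)$. (When $p=1$ we have $v_p=v_1$ and the added path is closed, i.e. a directed cycle through $v_1$.) *)

theory Defs
  imports
    "Graph_Theory.Graph_Theory"
    "Jordan_Normal_Form.Spectral_Radius"
    "HOL-Number_Theory.Cong"
begin

section \<open>The signless Laplacian and the Q-index\<close>

text \<open>
  The matrices depend on an ordering \<open>vs\<close> of the vertex set.  Entries are complex because
  \<^const>\<open>spectral_radius\<close> is defined for complex matrices.
\<close>

definition adjacency_mat :: "'a list \<Rightarrow> ('a, 'b) pre_digraph \<Rightarrow> complex mat" where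
  "adjacency_mat vs G =
     mat (length vs) (length vs) (\<lambda>(i, j). if vs ! i \<rightarrow>\<^bsub>G\<^esub> vs ! j then 1 else 0)"

definition outdegree_mat :: "'a list \<Rightarrow> ('a, 'b) pre_digraph \<Rightarrow> complex mat" where
  "outdegree_mat vs G = mat_diag (length vs) (\<lambda>i. of_nat (out_degree G (vs ! i)))"

definition signless_laplacian :: "'a list \<Rightarrow> ('a, 'b) pre_digraph \<Rightarrow> complex mat" where
  "signless_laplacian vs G = outdegree_mat vs G + adjacency_mat vs G"

text \<open>
  The ordering is chosen arbitrarily; \<open>Q_index_eq\<close> below shows that the choice is irrelevant.
\<close>

definition Q_index :: "('a, 'b) pre_digraph \<Rightarrow> real" where
  "Q_index G =
     spectral_radius (signless_laplacian (SOME vs. distinct vs \<and> set vs = verts G) G)"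

lemma signless_laplacian_carrier [simp]:
  "signless_laplacian vs G \<in> carrier_mat (length vs) (length vs)"
  by (simp add: signless_laplacian_def outdegree_mat_def adjacency_mat_def)

lemma signless_laplacian_mult:
  assumes d: "distinct vs" and i: "i < length vs"
  shows "(signless_laplacian vs G *\<^sub>v vec (length vs) (\<lambda>j. x (vs ! j))) $ i
    = of_nat (out_degree G (vs ! i)) * x (vs ! i)
      + (\<Sum>w | w \<in> set vs \<and> vs ! i \<rightarrow>\<^bsub>G\<^esub> w. x w)"
proof -
  let ?n = "length vs"
  have "(signless_laplacian vs G *\<^sub>v vec ?n (\<lambda>j. x (vs ! j))) $ i
    = (\<Sum>j = 0..<?n. ((if i = j then of_nat (out_degree G (vs ! j)) else 0)
        + (if vs ! i \<rightarrow>\<^bsub>G\<^esub> vs ! j then 1 else 0)) * x (vs ! j))"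
    using i by (simp add: signless_laplacian_def outdegree_mat_def adjacency_mat_def
        mat_diag_def scalar_prod_def)
  also have "\<dots> = (\<Sum>j = 0..<?n. if i = j then of_nat (out_degree G (vs ! j)) * x (vs ! j) else 0)
      + (\<Sum>j = 0..<?n. if vs ! i \<rightarrow>\<^bsub>G\<^esub> vs ! j then x (vs ! j) else 0)"
    by (subst sum.distrib [symmetric], rule sum.cong) (auto simp: algebra_simps)
  also have "(\<Sum>j = 0..<?n. if i = j then of_nat (out_degree G (vs ! j)) * x (vs ! j) else 0)
      = of_nat (out_degree G (vs ! i)) * x (vs ! i)"
    using i by simp
  also have "(\<Sum>j = 0..<?n. if vs ! i \<rightarrow>\<^bsub>G\<^esub> vs ! j then x (vs ! j) else 0)
      = (\<Sum>w \<in> set vs. if vs ! i \<rightarrow>\<^bsub>G\<^esub> w then x w else 0)"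
    by (rule sum.reindex_bij_betw, rule bij_betw_nth) (use d in auto)
  also have "\<dots> = (\<Sum>w | w \<in> set vs \<and> vs ! i \<rightarrow>\<^bsub>G\<^esub> w. x w)"
    by (subst sum.inter_filter [symmetric]) simp_all
  finally show ?thesis .
qed

lemma eigenvalue_signless_laplacian_iff:
  fixes k :: complex
  assumes d: "distinct vs"
  shows "eigenvalue (signless_laplacian vs G) k \<longleftrightarrow>
    (\<exists>x. (\<exists>u \<in> set vs. x u \<noteq> 0) \<and>
      (\<forall>u \<in> set vs. of_nat (out_degree G u) * x u
         + (\<Sum>w | w \<in> set vs \<and> u \<rightarrow>\<^bsub>G\<^esub> w. x w) = k * x u))"
    (is "?L \<longleftrightarrow> (\<exists>x. ?R x)")
proof -
  let ?n = "length vs" and ?Q = "signless_laplacian vs G"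
  have dim: "dim_row ?Q = ?n"
    using signless_laplacian_carrier by blast
  have *: "eigenvector ?Q (vec ?n (\<lambda>j. x (vs ! j))) k \<longleftrightarrow> ?R x" for x
  proof -
    have nz: "vec ?n (\<lambda>j. x (vs ! j)) \<noteq> 0\<^sub>v ?n \<longleftrightarrow> (\<exists>u \<in> set vs. x u \<noteq> 0)"
      unfolding vec_eq_iff by (simp add: set_conv_nth) blast
    have "?Q *\<^sub>v vec ?n (\<lambda>j. x (vs ! j)) = k \<cdot>\<^sub>v vec ?n (\<lambda>j. x (vs ! j)) \<longleftrightarrow>
      (\<forall>i < ?n. (?Q *\<^sub>v vec ?n (\<lambda>j. x (vs ! j))) $ i = k * x (vs ! i))"
      by (auto simp: vec_eq_iff dim)
    also have "\<dots> \<longleftrightarrow> (\<forall>u \<in> set vs. of_nat (out_degree G u) * x u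
         + (\<Sum>w | w \<in> set vs \<and> u \<rightarrow>\<^bsub>G\<^esub> w. x w) = k * x u)"
      by (auto simp: signless_laplacian_mult [OF d] all_set_conv_all_nth)
    finally show ?thesis
      using nz by (simp add: eigenvector_def dim)
  qed
  show ?thesis
  proof
    assume ?L
    then obtain v where v: "eigenvector ?Q v k"
      by (auto simp: eigenvalue_def)
    define x where "x u = v $ (THE i. i < ?n \<and> vs ! i = u)" for u
    have "x (vs ! j) = v $ j" if "j < ?n" for j
    proof -
      have "(THE i. i < ?n \<and> vs ! i = vs ! j) = j"
        using d that by (auto simp: nth_eq_iff_index_eq)
      then show ?thesis by (simp add: x_def)
    qed
    then have "v = vec ?n (\<lambda>j. x (vs ! j))"
      using v by (auto simp: eigenvector_def dim)
    with v have "?R x" by (subst * [symmetric]) simp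
    then show "\<exists>x. ?R x" by (rule exI [of _ x])
  next
    assume "\<exists>x. ?R x"
    then obtain x where "?R x" ..
    then have "eigenvector ?Q (vec ?n (\<lambda>j. x (vs ! j))) k" by (subst *)
    then show ?L unfolding eigenvalue_def ..
  qed
qed

lemma Q_index_eq:
  assumes "distinct vs" "set vs = verts G"
  shows "Q_index G = spectral_radius (signless_laplacian vs G)"
proof -
  let ?ws = "SOME vs. distinct vs \<and> set vs = verts G"
  have ws: "distinct ?ws \<and> set ?ws = verts G"
    by (rule someI [of _ vs]) (use assms in simp)
  have "spectrum (signless_laplacian ?ws G) = spectrum (signless_laplacian vs G)"
    unfolding spectrum_def
    by (intro Collect_cong) (simp only: eigenvalue_signless_laplacian_iff [OF conjunct1 [OF ws]]
        eigenvalue_signless_laplacian_iff [OF assms(1)] conjunct2 [OF ws] assms(2))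
  then show ?thesis
    by (simp add: Q_index_def spectral_radius_def)
qed

section \<open>The digraph classes\<close>

definition bipartite_digraph :: "('a, 'b) pre_digraph \<Rightarrow> bool" where
  "bipartite_digraph G \<longleftrightarrow>
     (\<exists>U W. verts G = U \<union> W \<and> U \<inter> W = {} \<and>
        (\<forall>e \<in> arcs G. tail G e \<in> U \<and> head G e \<in> W \<or> tail G e \<in> W \<and> head G e \<in> U))"

definition complete_bipartite :: "nat \<Rightarrow> nat \<Rightarrow> nat pair_pre_digraph" where
  "complete_bipartite p q =
     \<lparr> pverts = {1..p + q},
       parcs = {1..p} \<times> {p + 1..p + q} \<union> {p + 1..p + q} \<times> {1..p} \<rparr>"

definition digraph_class :: "nat \<Rightarrow> nat \<Rightarrow> nat \<Rightarrow> 'a pair_pre_digraph set" where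
  "digraph_class n p q =
     {G. pair_digraph G \<and> strongly_connected G \<and> bipartite_digraph G \<and> card (pverts G) = n \<and>
       (\<exists>H :: 'a pair_pre_digraph. subgraph H G \<and> digraph_iso (complete_bipartite p q) H)}"

text \<open>
  Vertex \<open>i\<close> stands for $v_i$.  For \<open>p = 1\<close> the added path is a directed cycle through
  vertex \<open>1\<close>.
\<close>

definition B1 :: "nat \<Rightarrow> nat \<Rightarrow> nat \<Rightarrow> nat pair_pre_digraph" where
  "B1 n p q =
     \<lparr> pverts = {1..n},
       parcs = parcs (complete_bipartite p q) \<union> {(1, p + q + 1)} \<union>
         {(i, i + 1) | i. p + q + 1 \<le> i \<and> i \<le> n - 1} \<union> {(n, p)} \<rparr>"

end

theory Submission
  imports Defs
begin

text \<open>
  \<^bold>\<open>Reduction to an ear.\<close>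
  Let \<open>K\<close> be the copy of the complete bipartite digraph in \<open>G\<close>.  Since \<open>G\<close> is strongly connected
  and has further vertices, some path leaves \<open>K\<close>, runs through \<open>k \<ge> 1\<close> new vertices and returns to
  \<open>K\<close> (\<open>ex_ear\<close>).  Let \<open>H\<close> be \<open>K\<close> together with this ear.  The ear of \<open>B1 n p q\<close> has
  \<open>m = n - p - q\<close> new vertices, and \<open>k \<le> m\<close>.

  \<^bold>\<open>Bounding the Q-index by a test vector.\<close>
  The signless Laplacian acts on vectors by
  \<open>(Q x) u = \<Sum> (x u + x w)\<close>, summed over the arcs \<open>(u, w)\<close>, so its value on a nonnegative vector
  grows with the arc set.  A positive vector with \<open>Q x = r x\<close> forces the Q-index to be \<open>r\<close>
  (\<open>Q_index_eq_if_positive_eigenvector\<close>); a nonzero nonnegative vector with \<open>Q x \<ge> r x\<close> shows that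
  the Q-index is at least \<open>r\<close>, and in a strongly connected digraph greater than \<open>r\<close> if the
  inequality is strict somewhere (\<open>Q_index_gt_if_subinvariant\<close>).

  \<^bold>\<open>The test vector.\<close>
  Let the ear start at \<open>u\<close> in the part \<open>A\<close> of \<open>K\<close>, let \<open>B\<close> be the other part, and let
  \<open>r > p + q\<close>.  The equations \<open>Q x = r x\<close> for \<open>H\<close> at all vertices other than \<open>u\<close> have a positive
  solution, unique up to scaling: \<open>x\<close> is constant on \<open>A - {u}\<close> and on \<open>B\<close>, and is divided by
  \<open>r - 1\<close> at every step backwards along the ear.  Extended by zero to \<open>G\<close>, it satisfies
  \<open>Q x \<ge> r x\<close> as soon as the remaining number \<open>(Q x) u - r x u\<close>, the \<^emph>\<open>defect\<close>, is
  nonnegative, and the inequality is strict somewhere if the defect is positive or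
  \<open>G \<noteq> H\<close> (\<open>Q_index_ear_supergraph\<close>).

  \<^bold>\<open>Comparison.\<close>
  The Q-index \<open>r\<close> of \<open>B1 n p q\<close> is the root of its own defect
  (\<open>ex_Q_index_root\<close>).  At this \<open>r\<close> every ear with \<open>k \<le> m\<close> that can occur has nonnegative
  defect, and the defect is positive if \<open>k = m\<close>, unless the ear is of the type found in
  \<open>B1 n p q\<close> (\<open>defect_nonneg\<close>).  Hence the Q-index of \<open>G\<close> is at least \<open>r\<close>, with equality only
  if \<open>G = H\<close> and \<open>H\<close> is isomorphic to \<open>B1 n p q\<close>.
\<close>

section \<open>Lower and upper bounds for the Q-index\<close>

text \<open>The action of the signless Laplacian of the digraph with arc set \<open>E\<close> on a real vector.\<close>

definition Q_op :: "('a \<times> 'a) set \<Rightarrow> ('a \<Rightarrow> real) \<Rightarrow> 'a \<Rightarrow> real" where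
  "Q_op E x u = (\<Sum>w \<in> E `` {u}. x u + x w)"

lemma signless_laplacian_row_eq:
  fixes x :: "'a \<Rightarrow> complex"
  assumes G: "pair_fin_digraph G"
  shows "of_nat (out_degree (with_proj G) u) * x u
      + (\<Sum>w | w \<in> pverts G \<and> u \<rightarrow>\<^bsub>with_proj G\<^esub> w. x w) = (\<Sum>w \<in> parcs G `` {u}. x u + x w)"
proof -
  interpret pair_fin_digraph G by (fact G)
  have "out_arcs (with_proj G) u = Pair u ` (parcs G `` {u})"
    by (auto simp: out_arcs_def)
  then have "out_degree (with_proj G) u = card (parcs G `` {u})"
    by (simp add: out_degree_def card_image inj_on_def)
  moreover have "{w. w \<in> pverts G \<and> u \<rightarrow>\<^bsub>with_proj G\<^esub> w} = parcs G `` {u}"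
    using in_arcsD2 by auto
  ultimately show ?thesis by (simp add: sum.distrib)
qed

lemma eigenvalue_pair_digraph_iff:
  fixes k :: complex
  assumes "pair_fin_digraph G" and "distinct vs" "set vs = pverts G"
  shows "eigenvalue (signless_laplacian vs (with_proj G)) k \<longleftrightarrow>
    (\<exists>x. (\<exists>u \<in> pverts G. x u \<noteq> 0) \<and>
      (\<forall>u \<in> pverts G. (\<Sum>w \<in> parcs G `` {u}. x u + x w) = k * x u))"
  unfolding eigenvalue_signless_laplacian_iff [OF assms(2)] assms(3)
    signless_laplacian_row_eq [OF assms(1)] ..

text \<open>
  The upper bound compares an arbitrary eigenvector \<open>y\<close> with \<open>x\<close> at a vertex where the ratio
  \<open>norm (y u) / x u\<close> is largest.
\<close>

lemma Q_index_eq_if_positive_eigenvector: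
  assumes G: "pair_fin_digraph G" and ne: "pverts G \<noteq> {}"
    and pos: "\<And>u. u \<in> pverts G \<Longrightarrow> x u > 0"
    and eig: "\<And>u. u \<in> pverts G \<Longrightarrow> Q_op (parcs G) x u = r * x u"
  shows "Q_index (with_proj G) = r"
proof -
  interpret pair_fin_digraph G by (fact G)
  obtain vs where vs: "distinct vs" "set vs = pverts G"
    using finite_distinct_list [OF pair_finite_verts] by blast
  let ?M = "signless_laplacian vs (with_proj G)" and ?n = "length vs"
  have n: "?n > 0" using vs ne by auto
  have M: "?M \<in> carrier_mat ?n ?n" by simp
  have fin: "finite (pverts G)" by (rule pair_finite_verts)
  obtain u0 where u0: "u0 \<in> pverts G" using ne by blast
  have r0: "r \<ge> 0"
  proof -
    have "r * x u0 = Q_op (parcs G) x u0" using eig [OF u0] by simp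
    also have "\<dots> \<ge> 0" unfolding Q_op_def
      by (intro sum_nonneg add_nonneg_nonneg) (auto intro!: less_imp_le pos u0 in_arcsD2)
    finally show ?thesis using pos [OF u0] by (simp add: zero_le_mult_iff)
  qed
  have upper: "norm k \<le> r" if "eigenvalue ?M k" for k
  proof -
    from that obtain y where y0: "\<exists>u \<in> pverts G. y u \<noteq> 0"
      and y: "\<And>u. u \<in> pverts G \<Longrightarrow> (\<Sum>w \<in> parcs G `` {u}. y u + y w) = k * y u"
      unfolding eigenvalue_pair_digraph_iff [OF G vs] by blast
    define f where "f u = norm (y u) / x u" for u
    obtain u where u: "u \<in> pverts G" and umax: "\<And>w. w \<in> pverts G \<Longrightarrow> f w \<le> f u"
    proof -
      have "Max (f ` pverts G) \<in> f ` pverts G" using fin ne by (intro Max_in) auto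
      then obtain u where u: "u \<in> pverts G" "f u = Max (f ` pverts G)" by force
      show thesis
        by (rule that [of u]) (use u fin in auto)
    qed
    have le: "norm (y w) \<le> f u * x w" if "w \<in> pverts G" for w
      using umax [OF that] pos [OF that] by (simp add: f_def [of w] divide_le_eq)
    have fu: "f u > 0"
    proof -
      obtain w where w: "w \<in> pverts G" "y w \<noteq> 0" using y0 by blast
      then have "f w > 0" using pos by (simp add: f_def)
      then show ?thesis using umax [OF w(1)] by linarith
    qed
    have yu: "norm (y u) = f u * x u" using pos [OF u] by (simp add: f_def)
    have "norm k * norm (y u) = norm (\<Sum>w \<in> parcs G `` {u}. y u + y w)"
      using y [OF u] by (simp add: norm_mult)
    also have "\<dots> \<le> (\<Sum>w \<in> parcs G `` {u}. f u * x u + f u * x w)"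
    proof (rule sum_norm_le)
      fix w assume "w \<in> parcs G `` {u}"
      then have "w \<in> pverts G" using in_arcsD2 by blast
      then show "norm (y u + y w) \<le> f u * x u + f u * x w"
        using le [OF u] le [of w] norm_triangle_ineq [of "y u" "y w"] by linarith
    qed
    also have "\<dots> = f u * Q_op (parcs G) x u"
      by (simp add: Q_op_def sum_distrib_left distrib_left)
    also have "\<dots> = r * norm (y u)" using eig [OF u] yu by simp
    finally show ?thesis using yu fu pos [OF u] by simp
  qed
  have "eigenvalue ?M (of_real r)"
    unfolding eigenvalue_pair_digraph_iff [OF G vs]
  proof (intro exI conjI ballI)
    show "\<exists>u\<in>pverts G. complex_of_real (x u) \<noteq> 0" using pos u0 by force
    fix u assume "u \<in> pverts G"
    from eig [OF this]
    show "(\<Sum>w \<in> parcs G `` {u}. complex_of_real (x u) + of_real (x w)) = of_real r * of_real (x u)"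
      by (simp add: Q_op_def flip: of_real_add of_real_mult of_real_sum)
  qed
  then have "r \<in> norm ` spectrum ?M"
    using r0 by (force simp: spectrum_def image_iff)
  then have "r \<le> spectral_radius ?M" by (rule spectral_radius_mem_max(2) [OF M n])
  moreover have "spectral_radius ?M \<le> r"
    using spectral_radius_mem_max(1) [OF M n] upper by (auto simp: spectrum_def)
  ultimately show ?thesis
    using Q_index_eq [of vs "with_proj G"] vs by simp
qed

lemma smult_mat_mult_vec:
  assumes "A \<in> carrier_mat m n" "v \<in> carrier_vec n"
  shows "(c \<cdot>\<^sub>m A) *\<^sub>v v = c \<cdot>\<^sub>v (A *\<^sub>v v)"
  using assms by (intro eq_vecI) (auto simp: scalar_prod_def sum_distrib_left mult.assoc)

lemma Q_op_mono:
  assumes "finite (E `` {u})" "x u \<le> y u" "\<And>w. (u, w) \<in> E \<Longrightarrow> x w \<le> y w"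
  shows "Q_op E x u \<le> Q_op E y u"
  unfolding Q_op_def using assms by (intro sum_mono add_mono) auto

lemma Q_op_scale: "Q_op E (\<lambda>v. c * x v) u = c * Q_op E x u"
  by (simp add: Q_op_def sum_distrib_left distrib_left)

lemma Q_op_add: "Q_op E (\<lambda>v. x v + y v) u = Q_op E x u + Q_op E y u"
  unfolding Q_op_def by (simp add: algebra_simps flip: sum.distrib)

text \<open>
  If the spectral radius were less than \<open>c < r\<close>, the powers of the matrix divided by \<open>c\<close> would be
  bounded; but applied to \<open>z\<close> they grow at least like \<open>(r / c) ^ k\<close>.
\<close>

lemma Q_index_ge_if_subinvariant:
  assumes G: "pair_fin_digraph G" and r: "r > 0"
    and nonneg: "\<And>u. u \<in> pverts G \<Longrightarrow> z u \<ge> 0" and u0: "u0 \<in> pverts G" "z u0 > 0"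
    and sub: "\<And>u. u \<in> pverts G \<Longrightarrow> r * z u \<le> Q_op (parcs G) z u"
  shows "Q_index (with_proj G) \<ge> r"
proof (rule ccontr)
  assume neg: "\<not> Q_index (with_proj G) \<ge> r"
  interpret pair_fin_digraph G by (fact G)
  obtain vs where vs: "distinct vs" "set vs = pverts G"
    using finite_distinct_list [OF pair_finite_verts] by blast
  let ?M = "signless_laplacian vs (with_proj G)" and ?n = "length vs"
  have n: "?n > 0" using vs u0 by auto
  have M: "?M \<in> carrier_mat ?n ?n" by simp
  have dimM: "dim_row ?M = ?n" "dim_col ?M = ?n" using M by (blast dest: carrier_matD)+
  have "spectral_radius ?M < r" using neg Q_index_eq [of vs "with_proj G"] vs by simp
  then obtain c where c: "spectral_radius ?M < c" "c < r" "c > 0"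
    using r dense [of "max 0 (spectral_radius ?M)" r] by auto
  define N where "N = (1 / complex_of_real c) \<cdot>\<^sub>m ?M"
  have N: "N \<in> carrier_mat ?n ?n" unfolding N_def by simp
  have "spectral_radius N < 1"
  proof -
    obtain k where k: "eigenvalue N k" "spectral_radius N = norm k"
      using spectral_radius_mem_max(1) [OF N n] by (auto simp: spectrum_def)
    then obtain v where v: "v \<in> carrier_vec ?n" "v \<noteq> 0\<^sub>v ?n" "N *\<^sub>v v = k \<cdot>\<^sub>v v"
      using N by (auto simp: eigenvalue_def eigenvector_def)
    have "?M = complex_of_real c \<cdot>\<^sub>m N" using c by (intro eq_matI) (auto simp: N_def)
    then have "?M *\<^sub>v v = complex_of_real c \<cdot>\<^sub>v (N *\<^sub>v v)"
      using N v by (simp add: smult_mat_mult_vec)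
    then have "?M *\<^sub>v v = (complex_of_real c * k) \<cdot>\<^sub>v v"
      using v by (simp add: smult_smult_assoc)
    then have "complex_of_real c * k \<in> spectrum ?M"
      unfolding spectrum_def eigenvalue_def eigenvector_def using v dimM by auto
    then have "norm (complex_of_real c * k) \<le> spectral_radius ?M"
      using spectral_radius_mem_max(2) [OF M n] by blast
    then have "c * norm k \<le> spectral_radius ?M" using c by (simp add: norm_mult)
    then have "c * norm k < c * 1" using c by linarith
    then have "norm k < 1" using c mult_less_cancel_left_pos by blast
    then show ?thesis using k by simp
  qed
  then obtain C where C: "\<And>k. norm_bound (N ^\<^sub>m k) C"
    using spectral_radius_jnf_norm_bound_less_1_upper_triangular [OF N] by blast
  define a where "a k = ((\<lambda>x v. inverse c * Q_op (parcs G) x v) ^^ k) z" for k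
  have a_Suc: "a (Suc k) u = inverse c * Q_op (parcs G) (a k) u" for k u
    by (simp add: a_def)
  define zv where "zv = vec ?n (\<lambda>j. complex_of_real (z (vs ! j)))"
  have pow: "N ^\<^sub>m k *\<^sub>v zv = vec ?n (\<lambda>j. complex_of_real (a k (vs ! j)))" for k
  proof -
    have step: "N *\<^sub>v vec ?n (\<lambda>j. complex_of_real (x (vs ! j)))
        = vec ?n (\<lambda>j. complex_of_real (inverse c * Q_op (parcs G) x (vs ! j)))" for x
    proof (rule eq_vecI)
      fix i assume "i < dim_vec (vec ?n (\<lambda>j. complex_of_real (inverse c * Q_op (parcs G) x (vs ! j))))"
      then have i: "i < ?n" by simp
      have "(N *\<^sub>v vec ?n (\<lambda>j. complex_of_real (x (vs ! j)))) $ i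
          = 1 / complex_of_real c * (?M *\<^sub>v vec ?n (\<lambda>j. complex_of_real (x (vs ! j)))) $ i"
        using i dimM by (simp add: N_def smult_mat_mult_vec [OF M])
      also have "(?M *\<^sub>v vec ?n (\<lambda>j. complex_of_real (x (vs ! j)))) $ i
          = complex_of_real (Q_op (parcs G) x (vs ! i))"
        using signless_laplacian_mult [OF vs(1) i, of "with_proj G" "\<lambda>v. complex_of_real (x v)"]
          signless_laplacian_row_eq [OF G, of "vs ! i" "\<lambda>v. complex_of_real (x v)"] vs(2)
        by (simp add: Q_op_def)
      finally show "(N *\<^sub>v vec ?n (\<lambda>j. complex_of_real (x (vs ! j)))) $ i
          = vec ?n (\<lambda>j. complex_of_real (inverse c * Q_op (parcs G) x (vs ! j))) $ i"
        using i by (simp add: divide_inverse)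
    qed (use N in auto)
    have "N ^\<^sub>m k *\<^sub>v vec ?n (\<lambda>j. complex_of_real (x (vs ! j)))
        = vec ?n (\<lambda>j. complex_of_real (((\<lambda>x v. inverse c * Q_op (parcs G) x v) ^^ k) x (vs ! j)))" for x
    proof (induction k arbitrary: x)
      case 0
      then show ?case using N by simp
    next
      case (Suc k)
      have "N ^\<^sub>m Suc k *\<^sub>v vec ?n (\<lambda>j. complex_of_real (x (vs ! j)))
        = N ^\<^sub>m k *\<^sub>v (N *\<^sub>v vec ?n (\<lambda>j. complex_of_real (x (vs ! j))))"
        using N by (simp add: assoc_mult_mat_vec [of _ ?n ?n _ ?n])
      then show ?case
        using Suc.IH [of "\<lambda>v. inverse c * Q_op (parcs G) x v"]
        by (simp only: step funpow_Suc_right o_apply)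
    qed
    then show ?thesis by (simp add: a_def zv_def)
  qed
  have grow: "(r / c) ^ k * z u \<le> a k u" if "u \<in> pverts G" for k u
    using that
  proof (induction k arbitrary: u)
    case 0 then show ?case by (simp add: a_def)
  next
    case (Suc k)
    have "(r / c) ^ Suc k * z u = inverse c * ((r / c) ^ k * (r * z u))"
      by (simp add: field_simps)
    also have "\<dots> \<le> inverse c * ((r / c) ^ k * Q_op (parcs G) z u)"
      using c r sub [OF Suc.prems] by (intro mult_left_mono) auto
    also have "\<dots> = inverse c * Q_op (parcs G) (\<lambda>v. (r / c) ^ k * z v) u"
      by (simp add: Q_op_scale)
    also have "\<dots> \<le> inverse c * Q_op (parcs G) (a k) u"
    proof (intro mult_left_mono Q_op_mono)
      show "finite (parcs G `` {u})" using pair_finite_arcs by (rule finite_Image)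
    qed (use c Suc in_arcsD2 in auto)
    finally show ?case by (simp add: a_Suc)
  qed
  obtain i where i: "i < ?n" "vs ! i = u0" using u0 vs by (metis in_set_conv_nth)
  define B where "B = (\<Sum>j = 0..<?n. C * z (vs ! j))"
  have bound: "(r / c) ^ k * z u0 \<le> B" for k
  proof -
    have Nk: "N ^\<^sub>m k \<in> carrier_mat ?n ?n" using N by simp
    have "a k u0 \<le> norm ((N ^\<^sub>m k *\<^sub>v zv) $ i)"
      using i by (simp add: pow)
    also have "\<dots> = norm (\<Sum>j = 0..<?n. (N ^\<^sub>m k) $$ (i, j) * complex_of_real (z (vs ! j)))"
      using i carrier_matD [OF Nk] by (simp add: scalar_prod_def zv_def row_def)
    also have "\<dots> \<le> B" unfolding B_def
    proof (rule sum_norm_le)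
      fix j assume j: "j \<in> {0..<?n}"
      have "norm ((N ^\<^sub>m k) $$ (i, j)) \<le> C"
      proof -
        have "\<forall>i j. i < ?n \<longrightarrow> j < ?n \<longrightarrow> norm ((N ^\<^sub>m k) $$ (i, j)) \<le> C"
          using C [of k] unfolding norm_bound_def carrier_matD [OF Nk] .
        then show ?thesis using i j by simp
      qed
      moreover have "z (vs ! j) \<ge> 0" using j nth_mem [of j vs] vs(2) nonneg by simp
      ultimately show "norm ((N ^\<^sub>m k) $$ (i, j) * complex_of_real (z (vs ! j))) \<le> C * z (vs ! j)"
        unfolding norm_mult norm_of_real by (simp add: mult_right_mono)
    qed
    finally show ?thesis using grow [OF u0(1), of k] by linarith
  qed
  have "r / c > 1" using c by simp
  then obtain k where "B / z u0 < (r / c) ^ k" using real_arch_pow by blast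
  then have "B < (r / c) ^ k * z u0" using u0(2) by (simp only: pos_divide_less_eq)
  then show False using bound [of k] by linarith
qed

text \<open>
  Among all nonnegative vectors with \<open>Q x \<ge> r x\<close> that are strict somewhere, choose one that is strict
  at as many vertices as possible.  Adding a multiple of \<open>Q x - r x\<close> makes it strict also at
  the predecessors of strict vertices, so by strong connectivity it is strict everywhere and \<open>r\<close>
  can be increased.
\<close>

lemma Q_index_gt_if_subinvariant:
  assumes G: "pair_fin_digraph G" "strongly_connected (with_proj G)" and r: "r > 0"
    and nonneg: "\<And>u. u \<in> pverts G \<Longrightarrow> z u \<ge> 0"
    and sub: "\<And>u. u \<in> pverts G \<Longrightarrow> r * z u \<le> Q_op (parcs G) z u"
    and strict: "u0 \<in> pverts G" "r * z u0 < Q_op (parcs G) z u0"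
  shows "Q_index (with_proj G) > r"
proof -
  interpret pair_fin_digraph G by (fact G)
  let ?E = "parcs G"
  have finE: "finite (?E `` {u})" for u using pair_finite_arcs by (rule finite_Image)
  define gap where "gap x u = Q_op ?E x u - r * x u" for x u
  define S where "S x = {u \<in> pverts G. gap x u > 0}" for x
  define good where "good x \<longleftrightarrow> (\<forall>u \<in> pverts G. x u \<ge> 0 \<and> gap x u \<ge> 0) \<and> S x \<noteq> {}" for x
  have "good z" using nonneg sub strict by (auto simp: good_def gap_def S_def)
  moreover have "card (S x) < Suc (card (pverts G))" for x
    unfolding S_def using pair_finite_verts by (simp add: card_mono less_Suc_eq_le)
  ultimately obtain x where x: "good x" and xmax: "\<And>y. good y \<Longrightarrow> card (S y) \<le> card (S x)"
    using ex_has_greatest_nat [of good z "\<lambda>x. card (S x)" "Suc (card (pverts G))"] by auto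
  have x0: "x u \<ge> 0" "gap x u \<ge> 0" if "u \<in> pverts G" for u using x that by (auto simp: good_def)
  have closed: "u \<in> S x" if uw: "(u, w) \<in> ?E" "w \<in> S x" for u w
  proof (rule ccontr)
    assume u: "u \<notin> S x"
    \<comment> \<open>The factor \<open>1 / (2 * r)\<close> leaves half of the old gap at every vertex.\<close>
    define y where "y v = x v + 1 / (2 * r) * gap x v" for v
    have gapy: "gap y v = gap x v / 2 + 1 / (2 * r) * Q_op ?E (gap x) v" for v
      unfolding gap_def [of y] y_def Q_op_add Q_op_scale using r
      by (simp add: gap_def field_simps)
    have Qg: "Q_op ?E (gap x) v \<ge> 0" if "v \<in> pverts G" for v
      unfolding Q_op_def using that by (intro sum_nonneg add_nonneg_nonneg) (auto intro: x0 in_arcsD2)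
    have u': "u \<in> pverts G" using uw in_arcsD1 by blast
    have "0 < gap x u + gap x w" using uw x0 [OF u'] by (auto simp: S_def)
    also have "\<dots> \<le> Q_op ?E (gap x) u"
      unfolding Q_op_def using uw u'
      by (intro member_le_sum [of w _ "\<lambda>w. gap x u + gap x w"] finE add_nonneg_nonneg)
        (auto intro: x0 in_arcsD2)
    finally have "gap y u > 0" using r x0 [OF u'] by (simp add: gapy add_nonneg_pos)
    moreover have sub': "S x \<subseteq> S y"
      using r Qg by (auto simp: S_def gapy intro!: add_pos_nonneg)
    ultimately have "S x \<subset> S y" using u u' by (auto simp: S_def)
    then have "card (S x) < card (S y)"
      using pair_finite_verts by (intro psubset_card_mono) (auto simp: S_def)
    moreover have "good y"
      using x sub' r x0 Qg by (auto simp: good_def gapy y_def intro!: add_nonneg_nonneg)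
    ultimately show False using xmax [of y] by linarith
  qed
  obtain s where s: "s \<in> S x" using x by (auto simp: good_def)
  have all: "u \<in> S x" if "u \<in> pverts G" for u
  proof -
    have "s \<in> pverts G" using s by (auto simp: S_def)
    then have "(u, s) \<in> ?E\<^sup>*"
      using G(2) that reachable_rtranclI [of "with_proj G" u s]
      by (simp add: strongly_connected_def)
    then show ?thesis
      by (induction rule: converse_rtrancl_induct) (use s closed in auto)
  qed
  have fin: "finite (pverts G)" "pverts G \<noteq> {}" using pair_finite_verts strict by auto
  have "\<exists>e > 0. \<forall>u \<in> pverts G. e * x u \<le> gap x u"
  proof -
    define m where "m = Min (gap x ` pverts G)"
    define b where "b = Max (x ` pverts G) + 1"
    have m: "m > 0" "\<And>u. u \<in> pverts G \<Longrightarrow> m \<le> gap x u"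
      unfolding m_def using fin all by (auto simp: S_def)
    have b: "x u \<le> b" if "u \<in> pverts G" for u
      using Max_ge [OF finite_imageI [OF fin(1)] imageI [OF that], of x]
      unfolding b_def by linarith
    have b0: "b > 0"
      using Max_ge [OF finite_imageI [OF fin(1)] imageI [OF strict(1)], of x] x0 [OF strict(1)]
      unfolding b_def by linarith
    have "m / b * x u \<le> gap x u" if "u \<in> pverts G" for u
    proof -
      have "m / b * x u \<le> m / b * b" using b [OF that] m b0 by (intro mult_left_mono) auto
      then show ?thesis using m(2) [OF that] b0 by simp
    qed
    then show ?thesis using m b0 by (intro exI [of _ "m / b"]) auto
  qed
  then obtain e where e: "e > 0" "\<And>u. u \<in> pverts G \<Longrightarrow> e * x u \<le> gap x u" by blast
  have xs: "\<exists>u \<in> pverts G. x u > 0"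
  proof (rule ccontr)
    assume "\<not> ?thesis"
    then have 0: "x u = 0" if "u \<in> pverts G" for u using x0(1) [OF that] that by force
    then have "Q_op ?E x s = 0"
      using s in_arcsD2 by (auto simp: Q_op_def S_def intro!: sum.neutral)
    then show False using s 0 by (auto simp: S_def gap_def)
  qed
  then obtain u1 where u1: "u1 \<in> pverts G" "x u1 > 0" by blast
  have "r + e \<le> Q_index (with_proj G)"
  proof (rule Q_index_ge_if_subinvariant [OF G(1), of _ x u1])
    fix u assume "u \<in> pverts G"
    then show "(r + e) * x u \<le> Q_op (parcs G) x u" 
      using e(2) [of u] by (simp add: gap_def algebra_simps)
  qed (use r e u1 x0 in auto)
  then show ?thesis using e by linarith
qed

section \<open>Isomorphisms and strong connectivity\<close>

lemma rtrancl_crosses_boundary: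
  assumes "(a, b) \<in> E\<^sup>*" "a \<in> S" "b \<notin> S"
  obtains x y where "(x, y) \<in> E" "x \<in> S" "y \<notin> S"
  using assms by (induction arbitrary: thesis rule: converse_rtrancl_induct) blast+

lemma strongly_connected_rtrancl:
  assumes "strongly_connected (with_proj G)" "a \<in> pverts G" "b \<in> pverts G"
  shows "(a, b) \<in> (parcs G)\<^sup>*"
  using assms reachable_rtranclI [of "with_proj G" a b] by (simp add: strongly_connected_def)

lemma inj_on_map_prod_parcs:
  assumes "pair_wf_digraph G" "inj_on f (pverts G)"
  shows "inj_on (map_prod f f) (parcs G)"
proof (rule inj_onI)
  interpret pair_wf_digraph G by fact
  fix a b assume "a \<in> parcs G" "b \<in> parcs G" "map_prod f f a = map_prod f f b"
  then show "a = b"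
    using assms(2) arc_fst_in_verts arc_snd_in_verts by (auto simp: prod_eq_iff inj_on_eq_iff)
qed

lemma digraph_iso_pairI:
  assumes "pair_wf_digraph G" and inj: "inj_on f (pverts G)"
    and H: "pverts H = f ` pverts G" "parcs H = map_prod f f ` parcs G"
  shows "digraph_iso (with_proj G) (with_proj H)"
proof -
  interpret pair_wf_digraph G by fact
  let ?h = "\<lparr>iso_verts = f, iso_arcs = map_prod f f, iso_head = snd, iso_tail = fst\<rparr>"
  have "inj_on (map_prod f f) (parcs G)"
    using assms(1) inj by (rule inj_on_map_prod_parcs)
  then have "pre_digraph.digraph_isomorphism (with_proj G) ?h"
    using inj wf_digraph by (auto simp: pre_digraph.digraph_isomorphism_def)
  moreover have "with_proj H = app_iso ?h (with_proj G)"
    using H by (simp add: with_proj_def app_iso_def)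
  ultimately show ?thesis unfolding digraph_iso_def by blast
qed

lemma digraph_iso_pairE:
  assumes "digraph_iso (with_proj G) (with_proj H)"
  obtains f where "inj_on f (pverts G)" "pverts H = f ` pverts G" "parcs H = map_prod f f ` parcs G"
    and "pair_wf_digraph G"
proof -
  obtain h where h: "pre_digraph.digraph_isomorphism (with_proj G) h"
    and H: "with_proj H = app_iso h (with_proj G)"
    using assms unfolding digraph_iso_def by blast
  have V: "pverts H = iso_verts h ` pverts G" and E: "parcs H = iso_arcs h ` parcs G"
    and t: "iso_tail h = fst" "iso_head h = snd"
    using H by (auto simp: with_proj_def app_iso_def)
  have "iso_arcs h a = map_prod (iso_verts h) (iso_verts h) a" if "a \<in> parcs G" for a
    using h that t by (auto simp: pre_digraph.digraph_isomorphism_def prod_eq_iff)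
  then have "parcs H = map_prod (iso_verts h) (iso_verts h) ` parcs G"
    unfolding E by (rule image_cong [OF refl])
  moreover have "inj_on (iso_verts h) (pverts G)" "pair_wf_digraph G"
    using h by (auto simp: pre_digraph.digraph_isomorphism_def wf_digraph_wp_iff)
  ultimately show thesis using V that by blast
qed

lemma Q_index_digraph_iso:
  assumes iso: "digraph_iso (with_proj G) (with_proj H)" and fin: "finite (pverts G)"
  shows "Q_index (with_proj G) = Q_index (with_proj H)"
proof -
  \<comment> \<open>Corresponding vertex orderings even give the same matrix.\<close>
  obtain f where inj: "inj_on f (pverts G)" and V: "pverts H = f ` pverts G"
    and E: "parcs H = map_prod f f ` parcs G" and wf: "pair_wf_digraph G"
    using iso by (rule digraph_iso_pairE)
  interpret pair_wf_digraph G by (fact wf)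
  obtain vs where vs: "distinct vs" "set vs = pverts G"
    using finite_distinct_list [OF fin] by blast
  have inj2: "inj_on (map_prod f f) (parcs G)"
    by (rule inj_on_map_prod_parcs [OF wf inj])
  have arc: "(f x, f y) \<in> parcs H \<longleftrightarrow> (x, y) \<in> parcs G" if "x \<in> pverts G" "y \<in> pverts G" for x y
  proof
    assume "(f x, f y) \<in> parcs H"
    then obtain x' y' where *: "(x', y') \<in> parcs G" "f x = f x'" "f y = f y'"
      unfolding E by auto
    then have "x' = x" "y' = y"
      using that in_arcsD1 [OF *(1)] in_arcsD2 [OF *(1)] inj by (auto simp: inj_on_eq_iff)
    with * show "(x, y) \<in> parcs G" by simp
  next
    assume "(x, y) \<in> parcs G"
    then show "(f x, f y) \<in> parcs H" unfolding E by force
  qed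
  have out: "out_arcs (with_proj H) (f x) = map_prod f f ` out_arcs (with_proj G) x" if "x \<in> pverts G" for x
    using that inj in_arcsD1 by (auto simp: out_arcs_def E inj_on_eq_iff)
  have deg: "out_degree (with_proj H) (f x) = out_degree (with_proj G) x" if "x \<in> pverts G" for x
  proof -
    have "inj_on (map_prod f f) (out_arcs (with_proj G) x)"
      using inj2 by (rule inj_on_subset) (auto simp: out_arcs_def)
    then show ?thesis
      by (simp only: out_degree_def out [OF that] card_image)
  qed
  have mem: "vs ! i \<in> pverts G" if "i < length vs" for i using nth_mem [OF that] unfolding vs(2) .
  have "signless_laplacian (map f vs) (with_proj H) = signless_laplacian vs (with_proj G)"
    by (rule eq_matI)
      (auto simp: signless_laplacian_def outdegree_mat_def adjacency_mat_def mat_diag_def deg arc mem)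
  moreover have "Q_index (with_proj H) = spectral_radius (signless_laplacian (map f vs) (with_proj H))"
    using vs inj V by (intro Q_index_eq) (auto simp: distinct_map)
  moreover have "Q_index (with_proj G) = spectral_radius (signless_laplacian vs (with_proj G))"
    using vs by (intro Q_index_eq) auto
  ultimately show ?thesis by simp
qed

lemma map_prod_image_times: "map_prod f g ` (A \<times> B) = (f ` A) \<times> (g ` B)"
  by auto

section \<open>A complete bipartite digraph with an ear\<close>

text \<open>
  The arcs of the complete bipartite digraph with parts \<open>A\<close> and \<open>B\<close>, together with those of the
  path from \<open>u\<close> through the list \<open>ws\<close> to \<open>v\<close>: its \<open>i\<close>-th arc leads from the \<open>i\<close>-th entry of
  \<open>u # ws\<close> to the \<open>i\<close>-th entry of \<open>ws @ [v]\<close>.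
\<close>

definition ear_arcs :: "'a set \<Rightarrow> 'a set \<Rightarrow> 'a \<Rightarrow> 'a list \<Rightarrow> 'a \<Rightarrow> ('a \<times> 'a) set" where
  "ear_arcs A B u ws v =
     A \<times> B \<union> B \<times> A \<union> {((u # ws) ! i, (ws @ [v]) ! i) | i. i \<le> length ws}"

lemma map_prod_ear_arcs:
  "map_prod f f ` ear_arcs A B u ws v = ear_arcs (f ` A) (f ` B) (f u) (map f ws) (f v)"
proof -
  have *: "(f ((u # ws) ! i), f ((ws @ [v]) ! i)) = ((f u # map f ws) ! i, (map f ws @ [f v]) ! i)"
    if "i \<le> length ws" for i
    using that by (cases i) (auto simp: nth_append)
  have "map_prod f f ` {((u # ws) ! i, (ws @ [v]) ! i) | i. i \<le> length ws}
      = {(f ((u # ws) ! i), f ((ws @ [v]) ! i)) | i. i \<le> length ws}" 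
    by (auto simp: image_iff)
  also have "\<dots> = {((f u # map f ws) ! i, (map f ws @ [f v]) ! i) | i. i \<le> length ws}"
    by (rule Collect_cong) (metis (no_types, lifting) *)
  finally show ?thesis
    by (simp add: ear_arcs_def image_Un map_prod_image_times)
qed

text \<open>
  The ear starts in the part called \<open>A\<close>; this is no restriction, since \<open>ear_arcs\<close> is symmetric in
  the two parts.  It may end in either part, and also at its starting point.
\<close>

locale ear =
  fixes A B :: "'a set" and u :: 'a and ws :: "'a list" and v :: 'a
  assumes fin: "finite A" "finite B" and disj: "A \<inter> B = {}"
    and B_ne: "B \<noteq> {}" and u: "u \<in> A" and v: "v \<in> A \<union> B"
    and ws: "ws \<noteq> []" "distinct ws" "set ws \<inter> (A \<union> B) = {}"
begin

lemma ear_cases: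
  assumes "(x, y) \<in> ear_arcs A B u ws v"
  shows "x \<in> A \<and> y \<in> B \<or> x \<in> B \<and> y \<in> A \<or> x = u \<and> y = ws ! 0
    \<or> (\<exists>i < length ws. x = ws ! i \<and> y = (ws @ [v]) ! Suc i)"
proof -
  have "\<exists>i \<le> length ws. x = (u # ws) ! i \<and> y = (ws @ [v]) ! i"
    if "\<not> (x \<in> A \<and> y \<in> B)" "\<not> (x \<in> B \<and> y \<in> A)"
    using assms that by (auto simp: ear_arcs_def)
  moreover have "x = u \<and> y = ws ! 0 \<or> (\<exists>i < length ws. x = ws ! i \<and> y = (ws @ [v]) ! Suc i)"
    if "i \<le> length ws" "x = (u # ws) ! i" "y = (ws @ [v]) ! i" for i
    using that ws(1) by (cases i) (auto simp: nth_append)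
  ultimately show ?thesis by blast
qed

lemma ear_arcs_path:
  "(u, ws ! 0) \<in> ear_arcs A B u ws v"
  "i < length ws \<Longrightarrow> (ws ! i, (ws @ [v]) ! Suc i) \<in> ear_arcs A B u ws v"
proof -
  have "(u, ws ! 0) = ((u # ws) ! 0, (ws @ [v]) ! 0)"
    using ws(1) by (simp add: nth_append)
  then show "(u, ws ! 0) \<in> ear_arcs A B u ws v"
    unfolding ear_arcs_def by blast
  assume i: "i < length ws"
  then have "(ws ! i, (ws @ [v]) ! Suc i) = ((u # ws) ! Suc i, (ws @ [v]) ! Suc i) \<and> Suc i \<le> length ws"
    by simp
  then show "(ws ! i, (ws @ [v]) ! Suc i) \<in> ear_arcs A B u ws v"
    unfolding ear_arcs_def by blast
qed

lemma ws_nth: "i < length ws \<Longrightarrow> ws ! i \<notin> A" "i < length ws \<Longrightarrow> ws ! i \<notin> B"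
  using ws(3) nth_mem by fastforce+

lemma succs:
  "x \<in> A - {u} \<Longrightarrow> ear_arcs A B u ws v `` {x} = B"
  "x \<in> B \<Longrightarrow> ear_arcs A B u ws v `` {x} = A"
  "ear_arcs A B u ws v `` {u} = insert (ws ! 0) B"
  "i < length ws \<Longrightarrow> ear_arcs A B u ws v `` {ws ! i} = {(ws @ [v]) ! Suc i}"
proof -
  have AB: "A \<times> B \<subseteq> ear_arcs A B u ws v" "B \<times> A \<subseteq> ear_arcs A B u ws v"
    by (auto simp: ear_arcs_def)
  show "ear_arcs A B u ws v `` {x} = B" if x: "x \<in> A - {u}"
    using AB x disj ws_nth by (auto dest!: ear_cases)
  show "ear_arcs A B u ws v `` {x} = A" if x: "x \<in> B"
    using AB x u disj ws_nth by (auto dest!: ear_cases)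
  show "ear_arcs A B u ws v `` {u} = insert (ws ! 0) B"
  proof (rule equalityI)
    show "ear_arcs A B u ws v `` {u} \<subseteq> insert (ws ! 0) B"
      using u disj ws_nth by (auto dest!: ear_cases)
    show "insert (ws ! 0) B \<subseteq> ear_arcs A B u ws v `` {u}"
      using AB u ear_arcs_path(1) by auto
  qed
  show "ear_arcs A B u ws v `` {ws ! i} = {(ws @ [v]) ! Suc i}" if i: "i < length ws"
  proof (rule equalityI)
    show "ear_arcs A B u ws v `` {ws ! i} \<subseteq> {(ws @ [v]) ! Suc i}"
      using i u ws_nth ws(2) by (auto dest!: ear_cases simp: nth_eq_iff_index_eq)
    show "{(ws @ [v]) ! Suc i} \<subseteq> ear_arcs A B u ws v `` {ws ! i}"
      using ear_arcs_path(2) [OF i] by simp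
  qed
qed

text \<open>The vertex set of the digraph.\<close>

definition V where "V = A \<union> B \<union> set ws"

lemma fin_V: "finite V" and card_V: "card V = card A + card B + length ws"
  using fin disj ws by (auto simp: V_def card_Un_disjoint distinct_card Int_commute)

lemma ear_arcs_in_V: "(x, y) \<in> ear_arcs A B u ws v \<Longrightarrow> x \<in> V \<and> y \<in> V"
  using u v ws(1) by (auto dest!: ear_cases simp: V_def nth_append)

lemma V_subset_pverts:
  assumes "ear_arcs A B u ws v \<subseteq> parcs G" "pair_wf_digraph G"
  shows "V \<subseteq> pverts G"
proof -
  interpret pair_wf_digraph G by fact
  have "\<exists>y. (x, y) \<in> ear_arcs A B u ws v" if "x \<in> V" for x
  proof -
    consider "x \<in> A" | "x \<in> B" | i where "i < length ws" "x = ws ! i"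
      using \<open>x \<in> V\<close> by (auto simp: V_def in_set_conv_nth)
    then show ?thesis
    proof cases
      case 1 then show ?thesis using B_ne by (auto simp: ear_arcs_def)
    next
      case 2 then show ?thesis using u by (auto simp: ear_arcs_def)
    next
      case 3 then show ?thesis using ear_arcs_path(2) by blast
    qed
  qed
  then show ?thesis using assms(1) in_arcsD1 by blast
qed

text \<open>
  The value of the test vector at the end point \<open>v\<close> of the ear: the three cases are its values at
  \<open>u\<close>, on \<open>A - {u}\<close> and on \<open>B\<close>, in this order.
\<close>

definition end_weight :: "real \<Rightarrow> real" where
  "end_weight r = (if v = u then 1 + r * (r - real (card A + card B)) / card B
     else if v \<in> A then 1 else (r - card B) / card B)"

text \<open>
  The amount by which \<open>Q z\<close> exceeds \<open>r z\<close> at \<open>u\<close>, for the test vector \<open>z\<close> scaled to be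
  \<open>(r - card B) / card B\<close> on \<open>B\<close> (and hence \<open>1\<close> on \<open>A - {u}\<close>).
\<close>

definition defect :: "real \<Rightarrow> real" where
  "defect r = 1 + end_weight r / (r - 1) ^ length ws
     - (r - card B - 1) * r * (r - real (card A + card B)) / card B"

text \<open>
  The values \<open>y\<close> on \<open>B\<close> and \<open>s\<close> at \<open>u\<close> are those that solve the equations at the vertices of
  \<open>A - {u}\<close> and of \<open>B\<close>.  If \<open>A = {u}\<close>, the first of these equations is void and the value of
  \<open>y\<close> is merely a normalisation.
\<close>

lemma test_vector:
  fixes r :: real
  assumes r: "r > card A + card B"
  shows "\<exists>z. (\<forall>x \<in> V. z x > 0) \<and> (\<forall>x. x \<notin> V \<longrightarrow> z x = 0) \<and>
    (\<forall>x \<in> V - {u}. Q_op (ear_arcs A B u ws v) z x = r * z x) \<and>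
    Q_op (ear_arcs A B u ws v) z u = r * z u + defect r"
proof -
  let ?E = "ear_arcs A B u ws v"
  define a b where "a = real (card A)" and "b = real (card B)"
  define D where "D = r * (r - a - b)"
  define s where "s = 1 + D / b"
  define y where "y = (r - b) / b"
  define k where "k = length ws"
  define c where "c = end_weight r"
  define z where "z x = (if x = u then s else if x \<in> A then 1 else if x \<in> B then y
    else if x \<in> set ws then c / (r - 1) ^ (k - the_inv_into {..<k} ((!) ws) x) else 0)" for x
  have ab: "a \<ge> 1" "b \<ge> 1" "r > a + b"
    using fin u B_ne r by (auto simp: a_def b_def Suc_le_eq card_gt_0_iff)
  have D: "D > 0" unfolding D_def using ab by simp
  have s0: "s > 1" using D ab by (simp add: s_def)
  have y0: "y > 0" using ab by (simp add: y_def)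
  have c: "c = (if v = u then s else if v \<in> A then 1 else y)"
    by (simp add: c_def end_weight_def s_def y_def a_def b_def D_def algebra_simps)
  have by_eq: "b * y = r - b" and bs_eq: "b * s = b + D"
    using ab by (simp_all add: y_def s_def distrib_left)
  have c0: "c > 0" using s0 y0 c by simp
  have inj: "inj_on ((!) ws) {..<k}" using ws(2) by (simp add: k_def inj_on_nth)
  have zu: "z u = s" by (simp add: z_def)
  have zA: "z x = 1" if "x \<in> A - {u}" for x using that by (simp add: z_def)
  have zB: "z x = y" if "x \<in> B" for x using that u disj by (auto simp: z_def)
  have zw: "z (ws ! i) = c / (r - 1) ^ (k - i)" if "i < k" for i
    using that ws_nth [of i] u the_inv_into_f_f [OF inj, of i]
    by (auto simp: z_def k_def)
  have zv: "z v = c" using v c zB u disj by (auto simp: z_def)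
  have pos: "z x > 0" if "x \<in> V" for x
    using that s0 y0 c0 ab by (auto simp: z_def V_def)
  have QB: "Q_op ?E z x = r * z x" if "x \<in> B" for x
  proof -
    have "Q_op ?E z x = (\<Sum>w \<in> A. y + z w)" using that zB by (simp add: Q_op_def succs)
    also have "\<dots> = (y + z u) + (\<Sum>w \<in> A - {u}. y + z w)"
      by (rule sum.remove [OF fin(1) u])
    also have "y + z u = y + s" by (simp only: zu)
    also have "(\<Sum>w \<in> A - {u}. y + z w) = (\<Sum>w \<in> A - {u}. y + 1)"
      by (rule sum.cong) (use zA in auto)
    also have "\<dots> = real (card (A - {u})) * (y + 1)" by simp
    also have "real (card (A - {u})) = a - 1"
      using fin u ab by (simp add: a_def card_Diff_singleton of_nat_diff)
    also have "(y + s) + (a - 1) * (y + 1) = r * y"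
    proof -
      have "b * ((y + s) + (a - 1) * (y + 1)) = b * (r * y)"
      proof -
        have "b * ((y + s) + (a - 1) * (y + 1)) = b * y + b * s + (a - 1) * (b * y + b)"
          by (simp add: algebra_simps)
        also have "\<dots> = r * (r - b)" unfolding by_eq bs_eq D_def by (simp add: algebra_simps)
        also have "\<dots> = r * (b * y)" unfolding by_eq ..
        finally show ?thesis by simp
      qed
      then show ?thesis using ab by simp
    qed
    finally show ?thesis using zB that by simp
  qed
  have QA: "Q_op ?E z x = r * z x" if "x \<in> A - {u}" for x
  proof -
    have "Q_op ?E z x = (\<Sum>w \<in> B. 1 + y)"
      using that zA zB by (simp add: Q_op_def succs del: sum_constant)
    also have "\<dots> = b + b * y" by (simp add: b_def distrib_left)
    also have "\<dots> = r" using by_eq by simp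
    finally show ?thesis using zA that by simp
  qed
  have Qw: "Q_op ?E z (ws ! i) = r * z (ws ! i)" if "i < k" for i
  proof -
    have "z ((ws @ [v]) ! Suc i) = c / (r - 1) ^ (k - Suc i)"
      using that zw [of "Suc i"] zv by (cases "Suc i < k") (auto simp: nth_append k_def not_less_eq less_Suc_eq)
    moreover have "(r - 1) ^ (k - i) = (r - 1) * (r - 1) ^ (k - Suc i)"
      using that by (simp add: Suc_diff_Suc flip: power_Suc)
    ultimately have "z ((ws @ [v]) ! Suc i) = (r - 1) * z (ws ! i)"
      using zw [OF that] ab by simp
    then show ?thesis
      using that by (simp add: Q_op_def succs k_def algebra_simps)
  qed
  have Qu: "Q_op ?E z u = r * z u + defect r"
  proof -
    have k: "k > 0" using ws by (simp add: k_def)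
    have "ws ! 0 \<notin> B" using k ws_nth by (simp add: k_def)
    then have "Q_op ?E z u = (s + z (ws ! 0)) + (\<Sum>w \<in> B. s + y)"
      using fin zu zB by (simp add: Q_op_def succs del: sum_constant)
    also have "\<dots> = s + c / (r - 1) ^ k + b * (s + y)" using zw [OF k] by (simp add: b_def)
    also have "\<dots> = r * s + defect r"
    proof -
      have "defect r = 1 + c / (r - 1) ^ k - (r - b - 1) * D / b"
        by (simp add: defect_def c_def k_def a_def b_def D_def algebra_simps)
      moreover have "s + b * (s + y) = r * s + 1 - (r - b - 1) * D / b"
      proof -
        have "b * (s + b * (s + y)) = b * (r * s + 1) - (r - b - 1) * D"
        proof -
          have "b * (s + b * (s + y)) = b * s + b * (b * s) + b * (b * y)"
            by (simp add: algebra_simps)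
          also have "\<dots> = r * (b + D) + b - (r - b - 1) * D"
            unfolding by_eq bs_eq by (simp add: algebra_simps)
          also have "\<dots> = r * (b * s) + b - (r - b - 1) * D" unfolding bs_eq ..
          finally show ?thesis by (simp add: algebra_simps)
        qed
        then show ?thesis using ab by (simp add: field_simps)
      qed
      ultimately show ?thesis by simp
    qed
    finally show ?thesis using zu by simp
  qed
  have "z x = 0" if "x \<notin> V" for x using that u by (auto simp: z_def V_def)
  moreover have "Q_op ?E z x = r * z x" if "x \<in> V - {u}" for x
    using that QA QB Qw by (auto simp: V_def in_set_conv_nth k_def)
  ultimately show ?thesis using pos Qu by (intro exI [of _ z]) blast
qed

lemma Q_index_ear:
  fixes r :: real
  assumes "pverts G = V" "parcs G = ear_arcs A B u ws v"
    and r: "r > card A + card B" and "defect r = 0"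
  shows "Q_index (with_proj G) = r"
proof -
  obtain z where z: "\<forall>x \<in> V. z x > 0" "\<forall>x. x \<notin> V \<longrightarrow> z x = 0"
    "\<forall>x \<in> V - {u}. Q_op (ear_arcs A B u ws v) z x = r * z x"
    "Q_op (ear_arcs A B u ws v) z u = r * z u + defect r"
    using test_vector [OF r] by (elim exE conjE) (rule that)
  have "parcs G \<subseteq> V \<times> V" using ear_arcs_in_V assms by auto
  then have "finite (parcs G)" using fin_V finite_subset by blast
  then have "pair_fin_digraph G"
    using assms fin_V ear_arcs_in_V by unfold_locales auto
  then show ?thesis
  proof (rule Q_index_eq_if_positive_eigenvector)
    show "pverts G \<noteq> {}" using u assms by (auto simp: V_def)
    show "z x > 0" if "x \<in> pverts G" for x using z that assms by simp
    show "Q_op (parcs G) z x = r * z x" if "x \<in> pverts G" for x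
      using z that assms by (cases "x = u") auto
  qed
qed

lemma Q_index_ear_supergraph:
  fixes r :: real
  assumes G: "pair_fin_digraph G" "strongly_connected (with_proj G)"
    and sub: "ear_arcs A B u ws v \<subseteq> parcs G"
    and r: "r > card A + card B" and d: "defect r \<ge> 0"
  shows "Q_index (with_proj G) \<ge> r" (is ?ge)
    and "defect r > 0 \<or> pverts G \<noteq> V \<or> parcs G \<noteq> ear_arcs A B u ws v \<Longrightarrow> Q_index (with_proj G) > r"
      (is "?strict \<Longrightarrow> ?gt")
proof -
  interpret pair_fin_digraph G by (fact G)
  let ?E = "ear_arcs A B u ws v"
  obtain z where z: "\<forall>x \<in> V. z x > 0" "\<forall>x. x \<notin> V \<longrightarrow> z x = 0"
    "\<forall>x \<in> V - {u}. Q_op ?E z x = r * z x"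
    "Q_op ?E z u = r * z u + defect r"
    using test_vector [OF r] by (elim exE conjE) (rule that)
  have r0: "r > 0" using r by (rule le_less_trans [rotated]) simp
  have z0: "z x \<ge> 0" for x using z(1,2) by (cases "x \<in> V") (auto simp: less_imp_le)
  have VG: "V \<subseteq> pverts G" using sub by (rule V_subset_pverts) unfold_locales
  have uV: "u \<in> V" using u by (simp add: V_def)
  have finE: "finite (parcs G `` {x})" for x using pair_finite_arcs by (rule finite_Image)
  have mono: "Q_op ?E z x \<le> Q_op (parcs G) z x" for x
    unfolding Q_op_def using sub finE z0 by (intro sum_mono2) auto
  have le: "r * z x \<le> Q_op ?E z x" if "x \<in> V" for x using z that d by (cases "x = u") auto
  have Q0: "Q_op (parcs G) z x \<ge> 0" for x
    unfolding Q_op_def using z0 by (intro sum_nonneg add_nonneg_nonneg) auto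
  have sub_inv: "r * z x \<le> Q_op (parcs G) z x" for x
    using le [of x] mono [of x] z(2) Q0 [of x] by (cases "x \<in> V") auto
  show ?ge
    using Q_index_ge_if_subinvariant [OF G(1) r0, of z u] z0 z(1) uV VG sub_inv by blast
  assume st: ?strict
  have "\<exists>x \<in> pverts G. r * z x < Q_op (parcs G) z x"
  proof -
    have new: "Q_op ?E z x + (z x + z y) \<le> Q_op (parcs G) z x"
      if "(x, y) \<in> parcs G" "(x, y) \<notin> ?E" for x y
    proof -
      have "Q_op ?E z x + (z x + z y) = (\<Sum>w \<in> insert y (?E `` {x}). z x + z w)"
      proof -
        have "finite (?E `` {x})" using sub by (intro finite_subset [OF _ finE [of x]]) blast
        moreover have "y \<notin> ?E `` {x}" using that by simp
        ultimately show ?thesis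
          unfolding Q_op_def by (subst sum.insert) (auto simp only: add.commute)
      qed
      also have "\<dots> \<le> Q_op (parcs G) z x"
        unfolding Q_op_def using that sub finE z0 by (intro sum_mono2) auto
      finally show ?thesis .
    qed
    consider "defect r > 0" | "pverts G \<noteq> V" | "pverts G = V" "parcs G \<noteq> ?E" using st by blast
    then show ?thesis
    proof cases
      case 1
      then have "r * z u < Q_op (parcs G) z u" using z(4) mono [of u] by linarith
      then show ?thesis using uV VG by blast
    next
      case 2
      then obtain x0 where "x0 \<in> pverts G" "x0 \<in> - V" using VG by blast
      then obtain x y where xy: "(x, y) \<in> parcs G" "x \<notin> V" "y \<in> V"
        using rtrancl_crosses_boundary [of x0 u "parcs G" "- V"] uV VG
          strongly_connected_rtrancl [OF G(2), of x0 u] by blast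
      then have "(x, y) \<notin> ?E" using ear_arcs_in_V by blast
      then have "Q_op ?E z x + (z x + z y) \<le> Q_op (parcs G) z x" using new xy by blast
      moreover have "Q_op ?E z x \<ge> 0"
        unfolding Q_op_def using z0 by (intro sum_nonneg add_nonneg_nonneg) auto
      moreover have "z x = 0" "z y > 0" using z xy by auto
      ultimately have "r * z x < Q_op (parcs G) z x" by simp
      then show ?thesis using xy in_arcsD1 by blast
    next
      case 3
      then obtain x y where xy: "(x, y) \<in> parcs G" "(x, y) \<notin> ?E" using sub by auto
      then have "x \<in> V" "y \<in> V" using 3 in_arcsD1 in_arcsD2 by blast+
      then have "r * z x < Q_op (parcs G) z x"
        using new [OF xy] le [of x] bspec [OF z(1), of x] bspec [OF z(1), of y] by linarith
      then show ?thesis using \<open>x \<in> V\<close> VG by blast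
    qed
  qed
  then show ?gt using Q_index_gt_if_subinvariant [OF G r0, of z] z0 sub_inv by blast
qed

end

section \<open>Existence of an ear\<close>

lemma ex_first_return_path:
  assumes "(w, b) \<in> E\<^sup>*" "b \<in> K" "w \<notin> K"
  shows "\<exists>ws v. ws \<noteq> [] \<and> ws ! 0 = w \<and> distinct ws \<and> set ws \<inter> K = {} \<and> v \<in> K \<and>
    (\<forall>i < length ws. (ws ! i, (ws @ [v]) ! Suc i) \<in> E)"
  using assms(1,3)
proof (induction rule: converse_rtrancl_induct)
  case base
  then show ?case using assms(2) by simp
next
  case (step x y)
  show ?case
  proof (cases "y \<in> K")
    case True
    then show ?thesis using step by (intro exI [of _ "[x]"] exI [of _ y]) auto
  next
    case False
    then obtain ws v where ws: "ws \<noteq> []" "ws ! 0 = y" "distinct ws" "set ws \<inter> K = {}" "v \<in> K"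
      and path: "\<forall>i < length ws. (ws ! i, (ws @ [v]) ! Suc i) \<in> E"
      using step.IH by blast
    show ?thesis
    proof (cases "x \<in> set ws")
      case True
      then obtain j where j: "j < length ws" "ws ! j = x" by (auto simp: in_set_conv_nth)
      have "set (drop j ws) \<inter> K = {}" using ws(4) set_drop_subset [of j ws] by blast
      moreover have "(drop j ws ! i, (drop j ws @ [v]) ! Suc i) \<in> E" if "i < length (drop j ws)" for i
      proof -
        have "(drop j ws @ [v]) ! Suc i = (ws @ [v]) ! Suc (j + i)"
          using j nth_drop [of j "ws @ [v]" "Suc i"] by simp
        moreover have "(ws ! (j + i), (ws @ [v]) ! Suc (j + i)) \<in> E" using path that by simp
        ultimately show ?thesis using j that by simp
      qed
      ultimately show ?thesis
        using j ws by (intro exI [of _ "drop j ws"] exI [of _ v]) simp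
    next
      case False
      have "((x # ws) ! i, ((x # ws) @ [v]) ! Suc i) \<in> E" if "i < length (x # ws)" for i
        using that path step.hyps(1) ws(1,2) by (cases i) (auto simp: nth_append)
      then show ?thesis
        using False ws step.prems by (intro exI [of _ "x # ws"] exI [of _ v]) simp
    qed
  qed
qed

lemma ex_ear:
  assumes G: "pair_fin_digraph G" "strongly_connected (with_proj G)"
    and K: "K \<subset> pverts G" "K \<noteq> {}"
  obtains u ws v where "u \<in> K" "v \<in> K" "ws \<noteq> []" "distinct ws" "set ws \<inter> K = {}"
    and "{((u # ws) ! i, (ws @ [v]) ! i) | i. i \<le> length ws} \<subseteq> parcs G"
proof -
  interpret pair_fin_digraph G by (fact G)
  obtain a b where ab: "a \<in> K" "b \<in> pverts G" "b \<notin> K" "a \<in> pverts G" using K by blast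
  then obtain u w where uw: "(u, w) \<in> parcs G" "u \<in> K" "w \<notin> K"
    using rtrancl_crosses_boundary [of a b "parcs G" K] strongly_connected_rtrancl [OF G(2), of a b]
    by blast
  have "(w, a) \<in> (parcs G)\<^sup>*"
    using strongly_connected_rtrancl [OF G(2)] uw(1) in_arcsD2 ab by blast
  from ex_first_return_path [OF this ab(1) uw(3)]
  obtain ws v where ws: "ws \<noteq> []" "ws ! 0 = w" "distinct ws" "set ws \<inter> K = {}" "v \<in> K"
    and path: "\<forall>i < length ws. (ws ! i, (ws @ [v]) ! Suc i) \<in> parcs G" by blast
  have "((u # ws) ! i, (ws @ [v]) ! i) \<in> parcs G" if "i \<le> length ws" for i
    using that path uw(1) ws(1,2) by (cases i) (auto simp: nth_append)
  then show thesis using that [of u v ws] uw ws by blast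
qed

section \<open>Isomorphism of complete bipartite digraphs with an ear\<close>

lemma ex_bij_betw_two_points:
  assumes fin: "finite A" "finite A'" and card: "card A = card A'"
    and uv: "u \<in> A" "v \<in> A" "u' \<in> A'" "v' \<in> A'" and eq: "u = v \<longleftrightarrow> u' = v'"
  obtains f where "bij_betw f A A'" "f u = u'" "f v = v'"
proof -
  have "card (A - {u, v}) = card (A' - {u', v'})"
    using assms by (subst (1 2) card_Diff_subset) auto
  then obtain g where g: "bij_betw g (A - {u, v}) (A' - {u', v'})"
    using finite_same_card_bij [of "A - {u, v}" "A' - {u', v'}"] fin by blast
  define f where "f x = (if x = u then u' else if x = v then v' else g x)" for x
  have "bij_betw f (A - {u, v}) (A' - {u', v'})"
    using g by (rule bij_betw_cong [THEN iffD1, rotated]) (auto simp: f_def)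
  moreover have "bij_betw f {u, v} {u', v'}"
    using eq by (auto simp: bij_betw_def f_def)
  ultimately have "bij_betw f ((A - {u, v}) \<union> {u, v}) ((A' - {u', v'}) \<union> {u', v'})"
    by (rule bij_betw_combine) auto
  moreover have "(A - {u, v}) \<union> {u, v} = A" "(A' - {u', v'}) \<union> {u', v'} = A'" using uv by auto
  ultimately show thesis using that [of f] eq by (auto simp: f_def)
qed

lemma ear_digraph_iso:
  assumes e: "ear A B u ws v" and e': "ear A' B' u' ws' v'"
    and card: "card A = card A'" "card B = card B'" "length ws = length ws'"
    and v: "v \<in> A" "v' \<in> A'" and eq: "u = v \<longleftrightarrow> u' = v'"
    and G: "pverts G = ear.V A B ws" "parcs G = ear_arcs A B u ws v"
    and G': "pverts G' = ear.V A' B' ws'" "parcs G' = ear_arcs A' B' u' ws' v'"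
  shows "digraph_iso (with_proj G) (with_proj G')"
proof -
  interpret e: ear A B u ws v by (fact e)
  interpret e': ear A' B' u' ws' v' by (fact e')
  obtain g where g: "bij_betw g A A'" "g u = u'" "g v = v'"
    using ex_bij_betw_two_points [OF e.fin(1) e'.fin(1) card(1) e.u v(1) e'.u v(2) eq] by blast
  obtain h where h: "bij_betw h B B'"
    using finite_same_card_bij [OF e.fin(2) e'.fin(2) card(2)] by blast
  let ?I = "{..<length ws}"
  have bw: "bij_betw ((!) ws) ?I (set ws)" "bij_betw ((!) ws') ?I (set ws')"
    using bij_betw_nth [OF e.ws(2) refl refl] bij_betw_nth [OF e'.ws(2) refl refl] card(3)
    by (simp_all add: lessThan_atLeast0)
  define l where "l = (!) ws' \<circ> inv_into ?I ((!) ws)"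
  have l: "bij_betw l (set ws) (set ws')"
    unfolding l_def using bij_betw_inv_into [OF bw(1)] bw(2) by (rule bij_betw_trans)
  have l_nth: "l (ws ! i) = ws' ! i" if "i < length ws" for i
    using that bij_betw_inv_into_left [OF bw(1), of i] by (simp add: l_def)
  define f where "f x = (if x \<in> A then g x else if x \<in> B then h x else l x)" for x
  have fA: "bij_betw f A A'"
    using g(1) by (rule bij_betw_cong [THEN iffD1, rotated]) (auto simp: f_def)
  have fB: "bij_betw f B B'"
    using h by (rule bij_betw_cong [THEN iffD1, rotated]) (use e.disj in \<open>auto simp: f_def\<close>)
  have fw: "bij_betw f (set ws) (set ws')"
    using l by (rule bij_betw_cong [THEN iffD1, rotated]) (use e.ws(3) in \<open>auto simp: f_def\<close>)
  have "bij_betw f (A \<union> B) (A' \<union> B')"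
    using fA fB e'.disj by (rule bij_betw_combine)
  then have fV: "bij_betw f (e.V) (e'.V)"
    unfolding e.V_def e'.V_def using fw by (rule bij_betw_combine) (use e'.ws(3) in blast)
  have fu: "f u = u'" "f v = v'" using g e.u v by (auto simp: f_def)
  have "map f ws = ws'"
    using card(3) l_nth e.ws_nth by (intro nth_equalityI) (auto simp: f_def)
  then have "ear_arcs A' B' u' ws' v' = map_prod f f ` ear_arcs A B u ws v"
    using fA fB fu by (simp add: map_prod_ear_arcs bij_betw_imp_surj_on)
  moreover have "pair_wf_digraph G"
    using e.ear_arcs_in_V G by unfold_locales auto
  ultimately show ?thesis
    using fV G G' by (intro digraph_iso_pairI [of _ f]) (auto simp: bij_betw_def)
qed

section \<open>The sign of the defect\<close>

text \<open>
  The left-hand side of the equation is the defect of \<open>B1 n p q\<close> for \<open>m = n - p - q\<close>; the case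
  distinction is that of \<open>end_weight\<close>, as the added path is closed exactly if \<open>p = 1\<close>.
  It is positive at \<open>r = p + q\<close>, where the last summand vanishes, and nonpositive at
  \<open>r = p + q + 2\<close>.
\<close>

lemma ex_Q_index_root:
  fixes p q m :: nat
  assumes q: "q \<ge> 1" and pq: "p \<ge> q" and m: "m \<ge> 1"
  obtains r :: real where "r > p + q"
    and "1 + (if p = 1 then 1 + r * (r - real (p + q)) / q else 1) / (r - 1) ^ m
      - (r - q - 1) * r * (r - real (p + q)) / q = 0"
proof -
  define N where "N = real (p + q)"
  define g where "g r = 1 + (if p = 1 then 1 + r * (r - N) / q else 1) / (r - 1) ^ m
      - (r - q - 1) * r * (r - N) / q" for r :: real
  have N: "N \<ge> 2" using q pq by (simp add: N_def)
  have low: "g N > 0" using N by (simp add: g_def add_pos_pos)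
  have high: "g (N + 2) \<le> 0"
  proof (cases "p = 1")
    case True
    then have "q = 1" using q pq by simp
    moreover have "(3::real) ^ 1 \<le> 3 ^ m" using m by (intro power_increasing) auto
    then have "9 / (3::real) ^ m \<le> 9 / 3" by (intro divide_left_mono) auto
    ultimately show ?thesis using True by (simp add: g_def N_def)
  next
    case False
    have "1 / (N + 1) ^ m \<le> 1" using N by (simp add: one_le_power)
    moreover have "2 \<le> (real p + 1) * (N + 2) * 2 / q"
    proof -
      have "2 * real q \<le> (real p + 1) * 2" using pq by simp
      also have "\<dots> \<le> (real p + 1) * (2 * (N + 2))" using N by (intro mult_left_mono) auto
      finally have "2 * real q \<le> (real p + 1) * (N + 2) * 2" by (simp only: mult_ac)
      then show ?thesis using q by (simp only: pos_le_divide_eq of_nat_0_less_iff Suc_le_eq One_nat_def)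
    qed
    moreover have "N + 2 - 1 = N + 1" "N + 2 - q - 1 = real p + 1" "N + 2 - N = 2"
      by (simp_all add: N_def)
    then have "g (N + 2) = 1 + 1 / (N + 1) ^ m - (real p + 1) * (N + 2) * 2 / q"
      using False by (simp only: g_def if_False)
    ultimately show ?thesis by linarith
  qed
  have "continuous_on {N..N + 2} g"
    unfolding g_def using N by (cases "p = 1") (use q in \<open>auto intro!: continuous_intros\<close>)
  then obtain r where r: "N \<le> r" "g r = 0"
    using IVT2' [of g "N + 2" 0 N] low high by (auto simp: less_imp_le)
  then have "r > N" using low by (cases "r = N") auto
  show thesis
  proof (rule that [of r])
    show "r > p + q" using \<open>r > N\<close> by (simp add: N_def)
    show "1 + (if p = 1 then 1 + r * (r - real (p + q)) / q else 1) / (r - 1) ^ m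
      - (r - q - 1) * r * (r - real (p + q)) / q = 0"
      using r(2) unfolding g_def N_def .
  qed
qed

text \<open>
  In a bipartite digraph the path alternates between the two classes, and its end points \<open>u\<close> and
  \<open>v\<close>, being adjacent, lie in different ones.
\<close>

lemma (in ear) cross_ear_even:
  assumes bip: "bipartite_digraph (with_proj G)" and G: "pair_wf_digraph G"
    and sub: "ear_arcs A B u ws v \<subseteq> parcs G" and vB: "v \<in> B"
  shows "even (length ws)"
proof -
  interpret pair_wf_digraph G by fact
  obtain U W where UW: "U \<inter> W = {}"
    "\<forall>e \<in> parcs G. fst e \<in> U \<and> snd e \<in> W \<or> fst e \<in> W \<and> snd e \<in> U"
    using bip by (auto simp: bipartite_digraph_def)
  have alt: "y \<in> U \<longleftrightarrow> x \<notin> U" if "(x, y) \<in> ear_arcs A B u ws v" for x y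
    using UW sub that by fastforce
  have "i \<le> Suc (length ws) \<Longrightarrow> (u # ws @ [v]) ! i \<in> U \<longleftrightarrow> (u \<in> U \<longleftrightarrow> even i)" for i
  proof (induction i)
    case 0 then show ?case by simp
  next
    case (Suc i)
    then have "((u # ws) ! i, (ws @ [v]) ! i) \<in> ear_arcs A B u ws v"
      by (auto simp: ear_arcs_def)
    moreover have "(u # ws) ! i = (u # ws @ [v]) ! i"
      using Suc.prems nth_append [of "u # ws" "[v]" i] by simp
    ultimately show ?case using Suc alt by simp
  qed
  from this [of "Suc (length ws)"] have "v \<in> U \<longleftrightarrow> (u \<in> U \<longleftrightarrow> odd (length ws))"
    by (simp add: nth_append)
  moreover have "(u, v) \<in> ear_arcs A B u ws v" using u vB by (simp add: ear_arcs_def)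
  then have "v \<in> U \<longleftrightarrow> u \<notin> U" by (rule alt)
  ultimately show ?thesis by blast
qed

text \<open>
  The number \<open>r\<close> is the Q-index of \<open>B1 n p q\<close> for \<open>n = p + q + m\<close>.  The excluded case \<open>p = 1\<close>,
  \<open>v \<in> B\<close>, \<open>length ws = m\<close> is a genuine exception: there the defect is negative.
\<close>

lemma (in ear) defect_nonneg:
  fixes p q m :: nat and r :: real
  assumes q: "q \<ge> 1" and pq: "p \<ge> q" and r: "r > p + q"
    and root: "1 + (if p = 1 then 1 + r * (r - real (p + q)) / q else 1) / (r - 1) ^ m
      - (r - q - 1) * r * (r - real (p + q)) / q = 0"
    and AB: "card A = p \<and> card B = q \<or> card A = q \<and> card B = p"
    and m: "length ws \<le> m" and par: "p = 1 \<Longrightarrow> v \<in> B \<Longrightarrow> length ws < m"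
  shows "defect r \<ge> 0"
    and "defect r > 0 \<or> length ws < m \<or>
      (length ws = m \<and> v \<in> A \<and> (u = v \<longleftrightarrow> p = 1) \<and> card A = p \<and> card B = q)"
proof -
  define D where "D = r * (r - real (p + q))"
  define t where "t = 1 / (r - 1) ^ m"
  define s where "s = 1 / (r - 1) ^ length ws"
  define b where "b = real (card B)"
  define c where "c = end_weight r"
  have r2: "r > 2" using r q pq by linarith
  have D: "D > 0" using r r2 by (simp add: D_def)
  have t: "t > 0" "s > 0" "t \<le> s"
    using r2 m by (auto simp: t_def s_def intro!: divide_left_mono power_increasing)
  have b: "b \<ge> 1" using AB q pq by (auto simp: b_def)
  have N: "card A + card B = p + q" using AB by auto
  have c: "c = (if v = u then 1 + D / b else if v \<in> A then 1 else (r - b) / b)"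
    by (simp add: c_def end_weight_def b_def D_def N)
  have d: "defect r = 1 + c * s - (r - b - 1) * D / b"
    by (simp add: defect_def c_def s_def b_def D_def N)
  have "defect r \<ge> 0 \<and> (defect r > 0 \<or> length ws < m \<or>
      (length ws = m \<and> v \<in> A \<and> (u = v \<longleftrightarrow> p = 1) \<and> card A = p \<and> card B = q))"
  proof (cases "p = 1")
    case True
    then have q1: "q = 1" using q pq by simp
    have b1: "b = 1" and A1: "card A = 1" "card B = 1" using AB True q1 by (auto simp: b_def)
    have D1: "1 + D = (r - 1) * (r - 1)" using True q1 by (simp add: D_def algebra_simps)
    have root': "1 + (1 + D) * t - (r - 2) * D = 0"
      using root True q1 unfolding D_def t_def by (simp add: mult.assoc)
    show ?thesis
    proof (cases "v \<in> A")
      case vA: True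
      then have vu: "v = u" using A1 u by (auto simp: card_1_singleton_iff)
      have "defect r = (1 + D) * s - (1 + D) * t"
        using d c vu b1 root' by simp
      then have "defect r \<ge> 0" using t D by simp
      then show ?thesis using m vA vu True A1 q1 by auto
    next
      case False
      then have vB: "v \<in> B" "v \<noteq> u" using v u by auto
      then have less: "length ws < m" using par True by blast
      have "(r - 1) ^ Suc (length ws) \<le> (r - 1) ^ m"
        using r2 less by (intro power_increasing) auto
      then have "t \<le> 1 / (r - 1) ^ Suc (length ws)"
        unfolding t_def using r2 by (intro divide_left_mono) auto
      then have "(r - 1) * t \<le> (r - 1) * (1 / (r - 1) ^ Suc (length ws))"
        using r2 by (intro mult_left_mono) auto
      also have "\<dots> = s" using r2 by (simp add: s_def)
      finally have "(r - 1) * t \<le> s" .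
      then have "(r - 1) * ((r - 1) * t) \<le> (r - 1) * s" using r2 by (intro mult_left_mono) auto
      moreover have "defect r = (r - 1) * s - (1 + D) * t"
        using d c vB False b1 root' by (simp add: algebra_simps)
      moreover have "(1 + D) * t = (r - 1) * ((r - 1) * t)" unfolding D1 by (rule mult.assoc)
      ultimately have "defect r \<ge> 0" by linarith
      then show ?thesis using less by blast
    qed
  next
    case False
    then have p2: "p \<ge> 2" using q pq by linarith
    have rq: "r - q - 1 > 0" using r p2 by simp
    have root': "(r - q - 1) * D = q * (1 + t)"
      using root False q by (simp add: D_def t_def field_simps)
    have b_pq: "b = q \<and> card A = p \<and> card B = q \<or> b = p \<and> card A = q \<and> card B = p"
      using AB by (auto simp: b_def)
    have le: "b * (r - q - 1) - q * (r - b - 1) = (b - q) * (r - 1)"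
      by (simp add: algebra_simps)
    have bq: "b \<ge> q" using b_pq pq by auto
    \<comment> \<open>For \<open>b = q\<close> the last summand of the defect is \<open>1 + t\<close>; in general it is \<open>e / b * (1 + t)\<close>,
      where \<open>e \<le> b\<close> because \<open>q \<le> b\<close>.\<close>
    define e where "e = q * (r - b - 1) / (r - q - 1)"
    have e: "(r - b - 1) * D / b = e / b * (1 + t)"
    proof -
      have "D = q * (1 + t) / (r - q - 1)" using root' rq by (simp add: eq_divide_eq mult.commute)
      then show ?thesis by (simp add: e_def mult_ac)
    qed
    have e_le: "e \<le> b"
    proof -
      have "(b - q) * (r - 1) \<ge> 0" using bq r2 by simp
      then show ?thesis using le rq by (simp add: e_def pos_divide_le_eq)
    qed
    have e_less: "e < b" if "b \<noteq> q"
    proof -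
      have "(b - q) * (r - 1) > 0" using bq r2 that by simp
      then show ?thesis using le rq by (simp add: e_def pos_divide_less_eq)
    qed
    show ?thesis
    proof (cases "v \<in> A")
      case True
      \<comment> \<open>A closed ear has \<open>c > 1\<close>, so it has a larger defect than an open one.\<close>
      have c1: "c \<ge> 1" "v = u \<Longrightarrow> c > 1" using c True D b by auto
      define x y where "x = e / b * (1 + t)" and "y = c * s"
      have d': "defect r = 1 + y - x" unfolding d e x_def y_def ..
      have x: "x \<le> 1 * (1 + t)"
        unfolding x_def using e_le b t by (intro mult_right_mono) auto
      have cs: "1 * s \<le> y" unfolding y_def using c1 t by (intro mult_right_mono) auto
      have nonneg: "defect r \<ge> 0" unfolding d' using x cs t(3) by simp
      have "defect r > 0" if "b \<noteq> q"
      proof -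
        have "x < 1 * (1 + t)"
          unfolding x_def using e_less [OF that] b t by (intro mult_strict_right_mono) auto
        then show ?thesis unfolding d' using cs t(3) by simp
      qed
      moreover have "defect r > 0" if "v = u"
      proof -
        have "1 * s < y" unfolding y_def using c1 that t by (intro mult_strict_right_mono) auto
        then show ?thesis unfolding d' using x t(3) by simp
      qed
      moreover have "card A = p \<and> card B = q" if "b = q" using b_pq that by auto
      ultimately show ?thesis using nonneg m True False by fastforce
    next
      case cross: False
      \<comment> \<open>Here \<open>c\<close> may be less than \<open>1\<close>, so that \<open>e \<le> b\<close> alone is not enough: \<open>e < r - b\<close> is
        used for the term with \<open>t\<close>.\<close>
      then have vB: "v \<in> B" "v \<noteq> u" using v u by auto
      have c': "c = (r - b) / b" using c cross vB by simp
      have rb: "r - b \<ge> 1" "r - b > q" using r b_pq q pq by auto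
      have e_r: "e < r - b"
      proof -
        have "q * (r - b - 1) < (r - b) * (r - q - 1)"
        proof -
          have "real q * (r - b - 1) \<le> q * (r - q - 1)" using bq q by (intro mult_left_mono) auto
          also have "\<dots> < (r - b) * (r - q - 1)" using rb rq by (intro mult_strict_right_mono) auto
          finally show ?thesis .
        qed
        then show ?thesis using rq by (simp add: e_def pos_divide_less_eq)
      qed
      have "e * (1 + t) < b + (r - b) * s"
      proof -
        have "e * t < (r - b) * t" using e_r t by (intro mult_strict_right_mono) auto
        also have "\<dots> \<le> (r - b) * s" using rb t by (intro mult_left_mono) auto
        finally show ?thesis using e_le by (simp add: distrib_left)
      qed
      then have "e * (1 + t) / b < (b + (r - b) * s) / b"
        using b by (intro divide_strict_right_mono) auto
      also have "(b + (r - b) * s) / b = 1 + c * s" using b by (simp add: c' add_divide_distrib)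
      finally have "e / b * (1 + t) < 1 + c * s" by simp
      then have "defect r > 0" using d e by simp
      then show ?thesis by simp
    qed
  qed
  then show "defect r \<ge> 0"
    and "defect r > 0 \<or> length ws < m \<or>
      (length ws = m \<and> v \<in> A \<and> (u = v \<longleftrightarrow> p = 1) \<and> card A = p \<and> card B = q)" by blast+
qed

section \<open>Comparison with the digraph \<open>B1 n p q\<close>\<close>

lemma ear_B1:
  assumes "q \<ge> 1" "p \<ge> q" "p + q < n"
  shows "ear {1..p} {p + 1..p + q} 1 [p + q + 1..<n + 1] p"
  using assms by unfold_locales auto

lemma pverts_B1:
  assumes "q \<ge> 1" "p \<ge> q" "p + q < n"
  shows "pverts (B1 n p q) = ear.V {1..p} {p + 1..p + q} [p + q + 1..<n + 1]"
  unfolding ear.V_def [OF ear_B1 [OF assms]] using assms by (auto simp: B1_def simp del: upt_Suc)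

lemma parcs_B1:
  assumes "q \<ge> 1" "p \<ge> q" "p + q < n"
  shows "parcs (B1 n p q) = ear_arcs {1..p} {p + 1..p + q} 1 [p + q + 1..<n + 1] p"
proof -
  let ?ws = "[p + q + 1..<n + 1]"
  have "{((1 # ?ws) ! i, (?ws @ [p]) ! i) | i. i \<le> length ?ws}
      = {(1, p + q + 1)} \<union> {(i, i + 1) | i. p + q + 1 \<le> i \<and> i \<le> n - 1} \<union> {(n, p)}" (is "?L = ?R")
  proof (intro equalityI subsetI)
    fix e assume "e \<in> ?L"
    then obtain i where i: "i \<le> n - (p + q)" "e = ((1 # ?ws) ! i, (?ws @ [p]) ! i)"
      by (auto simp del: upt_Suc)
    show "e \<in> ?R"
    proof (cases i)
      case 0
      then show ?thesis using i assms by (simp add: nth_append)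
    next
      case (Suc j)
      then show ?thesis using i assms
        by (cases "Suc j < n - (p + q)") (auto simp: nth_append nth_upt simp del: upt_Suc)
    qed
  next
    fix e assume "e \<in> ?R"
    then consider "e = (1, p + q + 1)" | j where "p + q + 1 \<le> j" "j \<le> n - 1" "e = (j, j + 1)"
      | "e = (n, p)" by auto
    then have "\<exists>i \<le> n - (p + q). e = ((1 # ?ws) ! i, (?ws @ [p]) ! i)"
    proof cases
      case 1
      then show ?thesis using assms
        by (intro exI [of _ 0]) (simp add: nth_append nth_upt del: upt_Suc)
    next
      case 2
      then show ?thesis using assms
        by (intro exI [of _ "j - (p + q)"])
          (auto simp: nth_append nth_upt nth_Cons split: nat.splits simp del: upt_Suc)
    next
      case 3
      then show ?thesis using assms
        by (intro exI [of _ "n - (p + q)"])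
          (auto simp: nth_append nth_upt nth_Cons split: nat.splits simp del: upt_Suc)
    qed
    then show "e \<in> ?L" by (auto simp del: upt_Suc)
  qed
  then show ?thesis by (simp add: B1_def complete_bipartite_def ear_arcs_def Un_assoc)
qed

text \<open>
  If the ear has fewer than \<open>n - p - q\<close> new vertices, then \<open>G\<close> has vertices outside it and the
  complete bipartite part, which makes the inequality strict even if the defect vanishes.
\<close>

lemma Q_index_vs_B1:
  fixes p q n :: nat
  assumes q: "q \<ge> 1" and pq: "p \<ge> q" and n: "p + q < n" and odd: "odd (n - (p + q))"
    and G: "pair_fin_digraph G" "strongly_connected (with_proj G)" "bipartite_digraph (with_proj G)"
    and cardG: "card (pverts G) = n"
    and e: "ear A B u ws v" and sub: "ear_arcs A B u ws v \<subseteq> parcs G"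
    and AB: "card A = p \<and> card B = q \<or> card A = q \<and> card B = p"
  shows "Q_index (with_proj G) > Q_index (with_proj (B1 n p q)) \<or>
    Q_index (with_proj G) = Q_index (with_proj (B1 n p q)) \<and> digraph_iso (with_proj G) (with_proj (B1 n p q))"
proof -
  interpret pair_fin_digraph G by (fact G)
  interpret e: ear A B u ws v by (fact e)
  interpret b: ear "{1..p}" "{p + 1..p + q}" 1 "[p + q + 1..<n + 1]" p
    using q pq n by (rule ear_B1)
  define m where "m = n - (p + q)"
  have m: "m \<ge> 1" using n by (simp add: m_def)
  obtain r :: real where r: "r > p + q"
    and root: "1 + (if p = 1 then 1 + r * (r - real (p + q)) / q else 1) / (r - 1) ^ m
      - (r - q - 1) * r * (r - real (p + q)) / q = 0"
    using ex_Q_index_root [OF q pq m] by blast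
  have "b.defect r = 0"
    unfolding b.defect_def b.end_weight_def using root q pq le_trans [OF q pq]
    by (cases "p = 1") (simp_all add: m_def del: upt_Suc)
  then have Q: "Q_index (with_proj (B1 n p q)) = r"
    using r by (intro b.Q_index_ear pverts_B1 parcs_B1 q pq n) auto
  have VG: "e.V \<subseteq> pverts G" using sub by (rule e.V_subset_pverts) unfold_locales
  have cardV: "card e.V = p + q + length ws" using e.card_V AB by auto
  have "card e.V \<le> n" using VG cardG pair_finite_verts card_mono by blast
  then have len: "length ws \<le> m" using cardV by (simp add: m_def)
  have par: "length ws < m" if "v \<in> B"
    using e.cross_ear_even [OF G(3) _ sub that] len odd
    by (metis le_neq_implies_less m_def pair_wf_digraph_axioms)
  have rAB: "r > card A + card B" using r AB by auto
  note d = e.defect_nonneg [OF q pq r root AB len par]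
  note Q_G = e.Q_index_ear_supergraph [OF G(1,2) sub rAB d(1)]
  show ?thesis
  proof (cases "e.defect r > 0 \<or> pverts G \<noteq> e.V \<or> parcs G \<noteq> ear_arcs A B u ws v")
    case True
    then show ?thesis using Q_G(2) Q by simp
  next
    case False
    then have "length ws = m" using cardV cardG n by (simp add: m_def)
    with d(2) False have "length ws = m" "v \<in> A" "u = v \<longleftrightarrow> p = 1" "card A = p" "card B = q"
      by auto
    then have "digraph_iso (with_proj G) (with_proj (B1 n p q))"
      using False n q pq
      by (intro ear_digraph_iso [OF e b.ear_axioms] pverts_B1 parcs_B1) (auto simp: m_def simp del: upt_Suc)
    then show ?thesis using Q_index_digraph_iso [OF _ pair_finite_verts] by blast
  qed
qed

theorem theorem3p9:
  fixes n p q :: nat and G :: "'a pair_pre_digraph"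
  assumes "p \<ge> q" and "q \<ge> 1"
    and "p + q \<le> n - 1"
    and "\<not> [n = p + q] (mod 2)"
    and "G \<in> digraph_class n p q"
  shows "Q_index G \<ge> Q_index (B1 n p q) \<and>
    (Q_index G = Q_index (B1 n p q) \<longleftrightarrow> digraph_iso G (B1 n p q))"
proof -
  from assms(5) have G: "pair_digraph G" "strongly_connected (with_proj G)"
    "bipartite_digraph (with_proj G)" "card (pverts G) = n"
    by (simp_all add: digraph_class_def)
  from assms(5) obtain H :: "'a pair_pre_digraph" where H: "subgraph (with_proj H) (with_proj G)"
    "digraph_iso (with_proj (complete_bipartite p q)) (with_proj H)"
    by (auto simp: digraph_class_def)
  interpret pair_digraph G by (fact G)
  have n: "p + q < n" using assms by linarith
  have odd: "odd (n - (p + q))"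
    using assms(4) n by (auto simp: cong_def mod2_eq_if split: if_splits)
  obtain f where f: "inj_on f (pverts (complete_bipartite p q))"
    "pverts H = f ` pverts (complete_bipartite p q)"
    and E: "parcs H = map_prod f f ` parcs (complete_bipartite p q)"
    using H(2) by (rule digraph_iso_pairE)
  have inj: "inj_on f {1..p + q}" and V: "pverts H = f ` {1..p + q}"
    using f by (simp_all add: complete_bipartite_def)
  define A where "A = f ` {1..p}"
  define B where "B = f ` {p + 1..p + q}"
  have AB: "A \<union> B = pverts H"
    unfolding V A_def B_def image_Un [symmetric] by (rule arg_cong [of _ _ "(`) f"]) auto
  have disj: "A \<inter> B = {}"
    unfolding A_def B_def using inj by (subst inj_on_image_Int [symmetric, of f "{1..p + q}"]) auto
  have cardAB: "card A = p" "card B = q"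
  proof -
    have "inj_on f {1..p}" "inj_on f {p + 1..p + q}"
      using inj by (rule inj_on_subset; auto)+
    then show "card A = p" "card B = q" by (simp_all add: A_def B_def card_image)
  qed
  have arcs: "A \<times> B \<union> B \<times> A \<subseteq> parcs G"
  proof -
    have "A \<times> B \<union> B \<times> A = parcs H"
      by (simp add: E complete_bipartite_def A_def B_def image_Un map_prod_image_times)
    then show ?thesis using H(1) by (auto simp: subgraph_def)
  qed
  have "card (A \<union> B) = p + q"
    using disj cardAB by (subst card_Un_disjoint) (auto simp: A_def B_def)
  then have "A \<union> B \<noteq> pverts G" "A \<union> B \<noteq> {}" using G(4) n assms(2) by auto
  moreover have "A \<union> B \<subseteq> pverts G" using AB H(1) by (auto simp: subgraph_def)
  ultimately have K: "A \<union> B \<subset> pverts G" "A \<union> B \<noteq> {}" by blast+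
  obtain u ws v where uv: "u \<in> A \<union> B" "v \<in> A \<union> B"
    and ws: "ws \<noteq> []" "distinct ws" "set ws \<inter> (A \<union> B) = {}"
    and path: "{((u # ws) ! i, (ws @ [v]) ! i) | i. i \<le> length ws} \<subseteq> parcs G"
    by (rule ex_ear [OF pair_fin_digraph_axioms G(2) K])
  have "\<exists>A' B'. ear A' B' u ws v \<and> ear_arcs A' B' u ws v \<subseteq> parcs G \<and>
      (card A' = p \<and> card B' = q \<or> card A' = q \<and> card B' = p)"
  proof (cases "u \<in> A")
    case True
    have "ear A B u ws v"
      using True uv ws disj cardAB assms(2) by unfold_locales (auto simp: A_def B_def)
    moreover have "ear_arcs A B u ws v \<subseteq> parcs G" using arcs path by (simp add: ear_arcs_def)
    ultimately show ?thesis using cardAB by blast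
  next
    case False
    have "ear B A u ws v"
      using False uv ws disj cardAB assms(1,2) by unfold_locales (auto simp: A_def B_def)
    moreover have "ear_arcs B A u ws v \<subseteq> parcs G" using arcs path by (simp add: ear_arcs_def)
    ultimately show ?thesis using cardAB by blast
  qed
  then obtain A' B' where e: "ear A' B' u ws v" "ear_arcs A' B' u ws v \<subseteq> parcs G"
    "card A' = p \<and> card B' = q \<or> card A' = q \<and> card B' = p" by blast
  from Q_index_vs_B1 [OF assms(2,1) n odd pair_fin_digraph_axioms G(2-4) e]
  show ?thesis
    using Q_index_digraph_iso [of G "B1 n p q"] pair_finite_verts by auto
qed

end
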